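(* Let $\mathcal{H}$ be a separable Hilbert space and let $\mathcal{M}$, $\mathcal{N}$ be nests on $\mathcal{H}$. If $d(\mathcal{T}(\mathcal{M}),\mathcal{T}(\mathcal{N})) < 1$, then $d(\mathcal{M},\mathcal{N}) < 1$; and consequently the nest algebras $\mathcal{T}(\mathcal{M})$ and $\mathcal{T}(\mathcal{N})$ are similar, i.e. there is an invertible $S\in\mathcal{B}(\mathcal{H})$ such that $\{SM : M\in\mathcal{M}\}=\mathcal{N}$, so that $S\,\mathcal{T}(\mathcal{M})\,S^{-1} = \mathcal{T}(\mathcal{N})$.
   Context: A nest on a Hilbert space $\mathcal{H}$ is a set $\mathcal{N}$ of closed subspaces of $\mathcal{H}$ which is totally ordered by inclusion, contains $\{0\}$ and $\mathcal{H}$, and is closed under arbitrary intersections and closed linear spans of subsets of $\mathcal{N}$. For a closed subspace $N$, $P_N$ denotes the orthogonal projection onto $N$. The nest algebra is $\mathcal{T}(\mathcal{N}) = \{T\in\mathcal{B}(\mathcal{H}) : TN\subseteq N \text{ for all } N\in\mathcal{N}\}$. The distance between two nests is $$d(\mathcal{M},\mathcal{N}) = \max\Big\{ \sup_{N\in\mathcal{N}}\inf_{M\in\mathcal{M}}\|P_N-P_M\|,\ \sup_{M\in\mathcal{M}}\inf_{N\in\mathcal{N}}\|P_N-P_M\|\Big\}.$$ The distance between two operator algebras $\mathcal{A},\mathcal{B}\subseteq\mathcal{B}(\mathcal{H})$ is $$d(\mathcal{A},\mathcal{B}) = \max\Big\{ \sup_{A\in b_1(\mathcal{A})}\inf_{B\in\mathcal{B}}\|A-B\|,\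 \sup_{B\in b_1(\mathcal{B})}\inf_{A\in\mathcal{A}}\|A-B\|\Big\},$$ where $b_1(\cdot)$ denotes the closed unit ball in operator norm. *)

theory Defs
  imports "HOL-Analysis.Analysis"
begin

text \<open>
  The classes extend \<^class>\<open>real_inner\<close>: the real inner product is the real part of the
  complex one, so norm, topology and \<^typ>\<open>'a \<Rightarrow>\<^sub>L 'a\<close> are the usual ones.
  \<open>cinner\<close> is linear in its first argument.
\<close>

class complex_inner = real_inner +
  fixes scaleC :: "complex \<Rightarrow> 'a \<Rightarrow> 'a" (infixr "*\<^sub>C" 75)
    and cinner :: "'a \<Rightarrow> 'a \<Rightarrow> complex"
  assumes scaleC_add_right: "c *\<^sub>C (x + y) = c *\<^sub>C x + c *\<^sub>C y"
    and scaleC_add_left: "(c + d) *\<^sub>C x = c *\<^sub>C x + d *\<^sub>C x"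
    and scaleC_scaleC: "c *\<^sub>C (d *\<^sub>C x) = (c * d) *\<^sub>C x"
    and scaleC_of_real: "complex_of_real r *\<^sub>C x = r *\<^sub>R x"
    and cinner_commute: "cinner x y = cnj (cinner y x)"
    and cinner_add_left: "cinner (x + y) z = cinner x z + cinner y z"
    and cinner_scaleC_left: "cinner (c *\<^sub>C x) y = c * cinner x y"
    and inner_eq_Re_cinner: "inner x y = Re (cinner x y)"

class complex_hilbert_space = complex_inner + complete_space

instantiation complex :: complex_hilbert_space
begin

definition scaleC_complex :: "complex \<Rightarrow> complex \<Rightarrow> complex" where
  "scaleC_complex c x = c * x"

definition cinner_complex :: "complex \<Rightarrow> complex \<Rightarrow> complex" where
  "cinner_complex x y = x * cnj y"

instance
  by standard
    (auto simp: scaleC_complex_def cinner_complex_def algebra_simps scaleR_conv_of_real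
      inner_complex_def)

end

global_interpretation complex_vector:
    vector_space "scaleC :: complex \<Rightarrow> 'a \<Rightarrow> 'a::complex_inner"
  defines csubspace_raw_def: csubspace = complex_vector.subspace
    and cspan_raw_def: cspan = complex_vector.span
proof unfold_locales
  show "1 *\<^sub>C x = x" for x :: 'a
    using scaleC_of_real[of 1 x] by simp
qed (simp_all add: scaleC_add_right scaleC_add_left scaleC_scaleC)

text \<open>
  \<^typ>\<open>'a \<Rightarrow>\<^sub>L 'a\<close> consists of the bounded real-linear maps; the complex-linear ones among
  them form the algebra of bounded operators.
\<close>

definition bounded_ops :: "('a::complex_hilbert_space \<Rightarrow>\<^sub>L 'a) set" where
  "bounded_ops = {T. \<forall>c x. blinfun_apply T (c *\<^sub>C x) = c *\<^sub>C blinfun_apply T x}"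

definition closed_csubspace :: "'a::complex_hilbert_space set \<Rightarrow> bool" where
  "closed_csubspace N \<longleftrightarrow> csubspace N \<and> closed N"

definition is_proj :: "'a::complex_hilbert_space set \<Rightarrow> ('a \<Rightarrow>\<^sub>L 'a) \<Rightarrow> bool" where
  "is_proj N P \<longleftrightarrow> (\<forall>x. P x \<in> N \<and> (\<forall>y\<in>N. cinner (x - P x) y = 0))"

definition proj :: "'a::complex_hilbert_space set \<Rightarrow> ('a \<Rightarrow>\<^sub>L 'a)" where
  "proj N = (THE P. is_proj N P)"

lemma cinner_zero_iff_inner:
  fixes N :: "'a::complex_inner set"
  assumes "csubspace N"
  shows "(\<forall>y\<in>N. cinner u y = 0) \<longleftrightarrow> (\<forall>y\<in>N. inner u y = 0)"
proof (intro iffI ballI)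
  fix y assume *: "\<forall>y\<in>N. inner u y = 0" and y: "y \<in> N"
  have "\<i> *\<^sub>C y \<in> N"
    using assms y by (rule complex_vector.subspace_scale)
  then have "Re (cinner u (\<i> *\<^sub>C y)) = 0" "Re (cinner u y) = 0"
    using * y by (simp_all add: inner_eq_Re_cinner[symmetric])
  moreover have "cinner u (\<i> *\<^sub>C y) = - \<i> * cinner u y"
    using cinner_commute[of u "\<i> *\<^sub>C y"] cinner_commute[of u y]
    by (simp add: cinner_scaleC_left)
  ultimately show "cinner u y = 0"
    by (simp add: complex_eq_iff)
qed (simp add: inner_eq_Re_cinner)

lemma csubspace_imp_subspace:
  "csubspace N \<Longrightarrow> subspace (N :: 'a::complex_inner set)"
  unfolding subspace_def
  by (metis complex_vector.subspace_0 complex_vector.subspace_add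
      complex_vector.subspace_scale scaleC_of_real)

lemma nearest_point_exists:
  fixes N :: "'a::{real_inner, complete_space} set"
  assumes sub: "subspace N" and cl: "closed N"
  shows "\<exists>p\<in>N. \<forall>y\<in>N. inner (x - p) y = 0"
proof -
  define d where "d = infdist x N"
  have ne: "N \<noteq> {}" using sub subspace_0 by blast
  have d0: "0 \<le> d" by (simp add: d_def infdist_nonneg)
  have dle: "d \<le> norm (x - y)" if "y \<in> N" for y
    using infdist_le[OF that, of x] by (simp add: d_def dist_norm)
  have "\<exists>y\<in>N. (norm (x - y))\<^sup>2 < d\<^sup>2 + 1 / real (Suc n)" for n
  proof -
    have "d < sqrt (d\<^sup>2 + 1 / real (Suc n))"
      by (rule real_less_rsqrt) simp
    then obtain y where "y \<in> N" "dist x y < sqrt (d\<^sup>2 + 1 / real (Suc n))"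
      using ne unfolding d_def infdist_def by (auto simp: cINF_less_iff)
    then have "(norm (x - y))\<^sup>2 < (sqrt (d\<^sup>2 + 1 / real (Suc n)))\<^sup>2"
      by (intro power_strict_mono) (auto simp: dist_norm)
    then show ?thesis
      using \<open>y \<in> N\<close> by (intro bexI[of _ y]) simp_all
  qed
  then obtain y where yN: "y n \<in> N"
    and y: "(norm (x - y n))\<^sup>2 < d\<^sup>2 + 1 / real (Suc n)" for n
    by metis
  have par: "(norm (y m - y n))\<^sup>2 \<le> 2 / real (Suc m) + 2 / real (Suc n)" for m n
  proof -
    have "(1/2) *\<^sub>R (y m + y n) \<in> N"
      using sub yN by (intro subspace_scale subspace_add)
    then have "d\<^sup>2 \<le> (norm (x - (1/2) *\<^sub>R (y m + y n)))\<^sup>2"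
      using dle d0 by (intro power_mono) auto
    moreover have "(norm (y m - y n))\<^sup>2 = 2 * (norm (x - y m))\<^sup>2 + 2 * (norm (x - y n))\<^sup>2
        - 4 * (norm (x - (1/2) *\<^sub>R (y m + y n)))\<^sup>2"
      by (simp add: power2_norm_eq_inner inner_diff inner_add inner_commute field_simps)
    ultimately show ?thesis using y[of m] y[of n] by simp
  qed
  have "Cauchy y"
  proof (rule CauchyI)
    fix e :: real assume e: "0 < e"
    obtain K where K: "4 / e\<^sup>2 < real (Suc K)"
      using reals_Archimedean2 less_trans of_nat_less_iff lessI by metis
    have "norm (y m - y n) < e" if "K \<le> m" "K \<le> n" for m n
    proof -
      have "2 / real (Suc m) \<le> 2 / real (Suc K)" "2 / real (Suc n) \<le> 2 / real (Suc K)"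
        using that by (auto intro!: divide_left_mono)
      then have "(norm (y m - y n))\<^sup>2 \<le> 4 / real (Suc K)"
        using par[of m n] by simp
      also have "\<dots> < e\<^sup>2" using K e by (simp add: field_simps)
      finally show ?thesis using e by (simp add: power2_less_imp_less)
    qed
    then show "\<exists>M. \<forall>m\<ge>M. \<forall>n\<ge>M. norm (y m - y n) < e" by blast
  qed
  then obtain p where lim: "y \<longlonglongrightarrow> p"
    using Cauchy_convergent convergent_def by blast
  have p: "p \<in> N" using closed_sequentially[OF cl yN lim] .
  have "(norm (x - p))\<^sup>2 \<le> d\<^sup>2 + 0"
  proof (rule LIMSEQ_le)
    show "(\<lambda>n. (norm (x - y n))\<^sup>2) \<longlonglongrightarrow> (norm (x - p))\<^sup>2"
      by (intro tendsto_intros lim)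
    show "(\<lambda>n. d\<^sup>2 + 1 / real (Suc n)) \<longlonglongrightarrow> d\<^sup>2 + 0"
      by (intro tendsto_intros LIMSEQ_Suc lim_1_over_n)
    show "\<exists>M. \<forall>n\<ge>M. (norm (x - y n))\<^sup>2 \<le> d\<^sup>2 + 1 / real (Suc n)"
      using y less_imp_le by blast
  qed
  then have min: "(norm (x - p))\<^sup>2 \<le> (norm (x - q))\<^sup>2" if "q \<in> N" for q
    using dle[OF that] d0 power_mono[of d "norm (x - q)" 2] by simp
  have "inner (x - p) z = 0" if z: "z \<in> N" for z
  proof (cases "z = 0")
    case False
    define t where "t = inner (x - p) z / inner z z"
    have "p + t *\<^sub>R z \<in> N" using sub p z by (intro subspace_scale subspace_add)
    note min[OF this]
    also have "(norm (x - (p + t *\<^sub>R z)))\<^sup>2 =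
        (norm (x - p))\<^sup>2 + (t\<^sup>2 * inner z z - 2 * t * inner (x - p) z)"
      unfolding power2_norm_eq_inner
      by (simp add: inner_diff inner_add inner_commute algebra_simps power2_eq_square)
    finally have "0 \<le> t\<^sup>2 * inner z z - 2 * t * inner (x - p) z" by simp
    also have "\<dots> = - (inner (x - p) z)\<^sup>2 / inner z z"
      using False by (simp add: t_def field_simps power2_eq_square)
    finally have "(inner (x - p) z)\<^sup>2 / inner z z \<le> 0" by simp
    moreover have "0 < inner z z" using False by simp
    ultimately show ?thesis by (simp add: pos_divide_le_eq)
  qed simp
  with p show ?thesis by blast
qed

lemma is_proj_proj:
  fixes N :: "'a::complex_hilbert_space set"
  assumes "closed_csubspace N"
  shows "is_proj N (proj N)"
proof -
  have cs: "csubspace N" and sub: "subspace N" and cl: "closed N"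
    using assms csubspace_imp_subspace by (auto simp: closed_csubspace_def)
  have uniq: "p = q" if "p \<in> N" "q \<in> N" "\<forall>y\<in>N. inner (x - p) y = 0"
    "\<forall>y\<in>N. inner (x - q) y = 0" for p q x
  proof -
    have "p - q \<in> N" using sub that by (intro subspace_diff)
    then have "inner (x - q) (p - q) - inner (x - p) (p - q) = 0"
      using that by simp
    then have "inner (p - q) (p - q) = 0"
      by (simp add: inner_diff_left algebra_simps)
    then show ?thesis by simp
  qed
  obtain f where fN: "f x \<in> N" and f: "\<forall>y\<in>N. inner (x - f x) y = 0" for x
    using nearest_point_exists[OF sub cl] by metis
  have bl: "bounded_linear f"
  proof (rule bounded_linear_intro)
    show "f (x + y) = f x + f y" for x y
      using f[of x] f[of y] f[of "x + y"] fN
      by (intro uniq[of _ _ "x + y"] subspace_add[OF sub])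
        (auto simp: inner_diff_left inner_add_left)
    show "f (r *\<^sub>R x) = r *\<^sub>R f x" for r x
      using f[of x] f[of "r *\<^sub>R x"] fN
      by (intro uniq[of _ _ "r *\<^sub>R x"] subspace_scale[OF sub])
        (auto simp: inner_diff_left)
    show "norm (f x) \<le> norm x * 1" for x
    proof -
      have "inner (x - f x) (f x) = 0" using f fN by blast
      then have "norm (f x) * norm (f x) = inner x (f x)"
        by (simp add: inner_diff_left norm_eq_square flip: power2_norm_eq_inner power2_eq_square)
      also have "\<dots> \<le> norm x * norm (f x)" by (rule norm_cauchy_schwarz)
      finally show ?thesis
        by (cases "f x = 0") auto
    qed
  qed
  have "is_proj N (Blinfun f)"
    using fN f by (simp add: is_proj_def bounded_linear_Blinfun_apply[OF bl]
        cinner_zero_iff_inner[OF cs])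
  moreover have "P = Q" if "is_proj N P" "is_proj N Q" for P Q
    using that uniq unfolding is_proj_def cinner_zero_iff_inner[OF cs]
    by (intro blinfun_eqI) blast
  ultimately show ?thesis
    unfolding proj_def by (intro theI'[of "is_proj N"] ex1I)
qed

definition is_nest :: "'a::complex_hilbert_space set set \<Rightarrow> bool" where
  "is_nest \<N> \<longleftrightarrow>
     (\<forall>N\<in>\<N>. closed_csubspace N) \<and>
     (\<forall>M\<in>\<N>. \<forall>N\<in>\<N>. M \<subseteq> N \<or> N \<subseteq> M) \<and>
     {0} \<in> \<N> \<and> UNIV \<in> \<N> \<and>
     (\<forall>\<S>\<subseteq>\<N>. \<Inter>\<S> \<in> \<N> \<and> closure (cspan (\<Union>\<S>)) \<in> \<N>)"

definition nest_algebra ::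
    "'a::complex_hilbert_space set set \<Rightarrow> ('a \<Rightarrow>\<^sub>L 'a) set" where
  "nest_algebra \<N> = {T \<in> bounded_ops. \<forall>N\<in>\<N>. blinfun_apply T ` N \<subseteq> N}"

text \<open>
  Both distances are real-valued suprema and infima.  They are only meaningful when the sets
  involved are nonempty and bounded, as is the case for nests and for subspaces of operators.
\<close>

definition nest_dist ::
    "'a::complex_hilbert_space set set \<Rightarrow> 'a set set \<Rightarrow> real" where
  "nest_dist \<M> \<N> =
     max (SUP N\<in>\<N>. INF M\<in>\<M>. norm (proj N - proj M))
         (SUP M\<in>\<M>. INF N\<in>\<N>. norm (proj N - proj M))"

definition alg_dist ::
    "('a::complex_hilbert_space \<Rightarrow>\<^sub>L 'a) set \<Rightarrow> ('a \<Rightarrow>\<^sub>L 'a) set \<Rightarrow> real" where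
  "alg_dist \<A> \<B> =
     max (SUP A\<in>{A \<in> \<A>. norm A \<le> 1}. INF B\<in>\<B>. norm (A - B))
         (SUP B\<in>{B \<in> \<B>. norm B \<le> 1}. INF A\<in>\<A>. norm (A - B))"

end

theory Submission
  imports Defs
begin

text \<open>
  Let \<open>P\<close> project onto a member of \<open>\<M>\<close> and \<open>Q\<close> onto a member \<open>N\<close> of \<open>\<N>\<close>.  Rank-one operators from
  the complement of \<open>N\<close> into \<open>N\<close> lie in the algebra of \<open>\<N>\<close>, and approximating them by elements of
  the algebra of \<open>\<M>\<close> bounds \<open>\<parallel>(1 - P) Q\<parallel> \<parallel>P (1 - Q)\<parallel>\<close> by some \<open>s\<^sup>2 < 1\<close>.  The same argument across a
  gap of \<open>\<N>\<close> yields, for each \<open>P\<close>, one \<open>Q\<close> with \<open>\<parallel>P - Q\<parallel> \<le> s\<close>.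

  For such nests, proximity is an order isomorphism \<open>\<theta>\<close>.  The similarity theorem for nests is not
  needed: by the Arveson distance formula (Parrott's theorem along finite subnests, then weak
  compactness) there is an operator \<open>Y\<close> with \<open>\<parallel>Y\<parallel> < 1\<close> such that \<open>S = 1 - Y\<close> maps each \<open>M\<close> into
  \<open>\<theta> M\<close>.  Then \<open>S\<close> is invertible, and it maps \<open>M\<close> onto \<open>\<theta> M\<close> because \<open>\<parallel>Q x - S x\<parallel> \<le> \<parallel>Y\<parallel> \<parallel>Q x\<parallel>\<close> on
  \<open>M\<close>, where \<open>Q\<close> projects onto \<open>\<theta> M\<close>.
\<close>

section \<open>Complex inner product spaces\<close>

lemma inner_scaleC_left:
  fixes x y :: "'a::complex_inner"
  shows "inner (c *\<^sub>C x) y = inner x (cnj c *\<^sub>C y)"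
proof -
  have "cinner x (cnj c *\<^sub>C y) = c * cinner x y"
    using cinner_commute[of x "cnj c *\<^sub>C y"] cinner_commute[of x y]
    by (simp add: cinner_scaleC_left)
  then show ?thesis
    by (simp add: inner_eq_Re_cinner cinner_scaleC_left)
qed

lemma norm_scaleC:
  fixes x :: "'a::complex_inner"
  shows "norm (c *\<^sub>C x) = cmod c * norm x"
proof -
  have "cnj c * c = complex_of_real ((cmod c)\<^sup>2)"
    by (metis complex_norm_square mult.commute)
  then have "inner (c *\<^sub>C x) (c *\<^sub>C x) = (cmod c)\<^sup>2 * inner x x"
    by (simp add: inner_scaleC_left scaleC_scaleC scaleC_of_real del: of_real_power)
  then show ?thesis
    by (simp add: norm_eq_sqrt_inner real_sqrt_mult)
qed

lemma cinner_self:
  fixes x :: "'a::complex_inner"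
  shows "cinner x x = complex_of_real ((norm x)\<^sup>2)"
proof -
  have "Im (cinner x x) = 0"
    using cinner_commute[of x x] by (simp add: complex_eq_iff)
  then show ?thesis
    by (simp add: complex_eq_iff power2_norm_eq_inner inner_eq_Re_cinner)
qed

lemma norm_cinner_le:
  fixes x y :: "'a::complex_inner"
  shows "cmod (cinner x y) \<le> norm x * norm y"
proof (cases "cinner x y = 0")
  case False
  \<comment> \<open>The unimodular factor \<open>u\<close> rotates \<open>x\<close> so that the
    complex inner product becomes real and nonnegative; the real Cauchy-Schwarz inequality then
    applies.\<close>
  define u where "u = cnj (cinner x y) / complex_of_real (cmod (cinner x y))"
  have u: "cmod u = 1"
    using False by (simp add: u_def norm_divide)
  have "u * cinner x y = complex_of_real (cmod (cinner x y))"
    using False complex_norm_square[of "cinner x y"]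
    by (simp add: u_def field_simps power2_eq_square)
  then have "cmod (cinner x y) = inner (u *\<^sub>C x) y"
    by (simp add: inner_eq_Re_cinner cinner_scaleC_left)
  also have "\<dots> \<le> norm (u *\<^sub>C x) * norm y"
    by (rule norm_cauchy_schwarz)
  finally show ?thesis
    by (simp add: norm_scaleC u)
qed simp

section \<open>Bounded complex-linear operators\<close>

lemma bounded_opsI:
  fixes T :: "'a::complex_hilbert_space \<Rightarrow>\<^sub>L 'a"
  shows "(\<And>c x. T (c *\<^sub>C x) = c *\<^sub>C T x) \<Longrightarrow> T \<in> bounded_ops"
  by (simp add: bounded_ops_def)

lemma bounded_ops_scaleC: "T \<in> bounded_ops \<Longrightarrow> T (c *\<^sub>C x) = c *\<^sub>C T x"
  by (simp add: bounded_ops_def)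

lemma bounded_ops_id: "id_blinfun \<in> bounded_ops"
  by (simp add: bounded_ops_def)

lemma bounded_ops_compose:
  "S \<in> bounded_ops \<Longrightarrow> T \<in> bounded_ops \<Longrightarrow> S o\<^sub>L T \<in> bounded_ops"
  by (simp add: bounded_ops_def)

lemma bounded_ops_add:
  "S \<in> bounded_ops \<Longrightarrow> T \<in> bounded_ops \<Longrightarrow> S + T \<in> bounded_ops"
  by (simp add: bounded_ops_def blinfun.add_left scaleC_add_right)

lemma bounded_ops_diff:
  "S \<in> bounded_ops \<Longrightarrow> T \<in> bounded_ops \<Longrightarrow> S - T \<in> bounded_ops"
  by (simp add: bounded_ops_def blinfun.diff_left complex_vector.scale_right_diff_distrib)

lemma bounded_ops_inverse:
  assumes "S \<in> bounded_ops" "S o\<^sub>L V = id_blinfun" "V o\<^sub>L S = id_blinfun"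
  shows "V \<in> bounded_ops"
proof (rule bounded_opsI)
  fix c x
  have "S (V y) = y" "V (S y) = y" for y
    using assms(2,3) by (metis blinfun_apply_blinfun_compose blinfun_apply_id_blinfun id_apply)+
  then show "V (c *\<^sub>C x) = c *\<^sub>C V x"
    using bounded_ops_scaleC[OF assms(1)] by metis
qed

section \<open>Functionals, forms and inverses\<close>

lemma riesz_representation:
  fixes f :: "'a::{real_inner, complete_space} \<Rightarrow> real"
  assumes f: "bounded_linear f"
  shows "\<exists>v. \<forall>x. f x = inner v x"
proof (cases "\<forall>x. f x = 0")
  case True
  then show ?thesis by (intro exI[of _ 0]) simp
next
  case False
  then obtain x0 where x0: "f x0 \<noteq> 0" by blast
  interpret f: bounded_linear f by fact
  have "subspace (f -` {0})"
    by (auto simp: subspace_def f.add f.scaleR)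
  moreover have "closed (f -` {0})"
    by (intro continuous_closed_vimage linear_continuous_at f) simp
  ultimately obtain p where p: "f p = 0" and orth: "\<And>y. f y = 0 \<Longrightarrow> inner (x0 - p) y = 0"
    using nearest_point_exists[of "f -` {0}" x0] by auto
  \<comment> \<open>\<open>w\<close> is the component of \<open>x0\<close> orthogonal to the kernel
    of \<open>f\<close>; subtracting a multiple of \<open>w\<close> moves any vector into the
    kernel.\<close>
  define w where "w = x0 - p"
  have fw: "f w \<noteq> 0" using x0 p by (simp add: w_def f.diff)
  then have w: "inner w w \<noteq> 0" using f.zero by auto
  show ?thesis
  proof (intro exI[of _ "(f w / inner w w) *\<^sub>R w"] allI)
    fix x
    have "f (x - (f x / f w) *\<^sub>R w) = 0"
      using fw by (simp add: f.diff f.scaleR)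
    from orth[OF this] have "inner w x = f x / f w * inner w w"
      by (simp add: inner_diff_right flip: w_def)
    then show "f x = inner ((f w / inner w w) *\<^sub>R w) x"
      using fw w by simp
  qed
qed

text \<open>The Riesz vector of \<open>f x\<close> serves as \<open>T x\<close>. This yields the
  operator \<open>C\<close> in \<open>parrott\<close> and the limit operator in
  \<open>interpolation_compactness\<close>.\<close>

lemma bounded_form_representation:
  fixes f :: "'a::{real_inner, complete_space} \<Rightarrow> 'a \<Rightarrow> real"
  assumes l: "\<And>y. linear (\<lambda>x. f x y)" and r: "\<And>x. linear (f x)"
    and bd: "\<And>x y. \<bar>f x y\<bar> \<le> c * norm x * norm y" and c: "0 \<le> c"
  obtains T :: "'a \<Rightarrow>\<^sub>L 'a" where "\<And>x y. inner (T x) y = f x y" "norm T \<le> c"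
proof -
  have "\<exists>v. \<forall>y. f x y = inner v y" for x
    using r[of x] bd[of x]
    by (intro riesz_representation bounded_linear_intro[where K = "c * norm x"])
      (auto simp: linear_add linear_scale mult.commute)
  then obtain t where t: "f x y = inner (t x) y" for x y
    by metis
  have eqI: "u = v" if "\<And>y. inner u y = inner v y" for u v :: 'a
    using vector_eq_rdot[of u v] that by (simp add: inner_commute)
  have bt: "norm (t x) \<le> norm x * c" for x
  proof -
    have "norm (t x) * norm (t x) = f x (t x)"
      by (simp add: t power2_norm_eq_inner flip: power2_eq_square)
    also have "\<dots> \<le> c * norm x * norm (t x)" using bd[of x "t x"] by simp
    finally show ?thesis by (cases "t x = 0") (auto simp: mult.commute c)
  qed
  have bl: "bounded_linear t"
  proof (rule bounded_linear_intro[OF _ _ bt])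
    show "t (x + y) = t x + t y" for x y
      by (rule eqI) (simp add: inner_add_left linear_add[OF l] flip: t)
    show "t (a *\<^sub>R x) = a *\<^sub>R t x" for a x
      by (rule eqI) (simp add: linear_scale[OF l] flip: t)
  qed
  show ?thesis
  proof (rule that[of "Blinfun t"])
    show "norm (Blinfun t) \<le> c"
      using bt c by (intro norm_blinfun_bound)
        (simp_all add: bounded_linear_Blinfun_apply[OF bl] mult.commute)
  qed (simp add: bounded_linear_Blinfun_apply[OF bl] t)
qed

text \<open>An operator obtained from a real form is a priori only real-linear; complex linearity is
  recovered from a condition on the form.\<close>

lemma bounded_opsI_inner:
  fixes T :: "'a::complex_hilbert_space \<Rightarrow>\<^sub>L 'a"
  assumes "\<And>c x y. inner (T (c *\<^sub>C x)) y = inner (T x) (cnj c *\<^sub>C y)"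
  shows "T \<in> bounded_ops"
proof (rule bounded_opsI)
  show "T (c *\<^sub>C x) = c *\<^sub>C T x" for c x
    using vector_eq_rdot[of "T (c *\<^sub>C x)" "c *\<^sub>C T x"] assms
    by (simp add: inner_scaleC_left)
qed

text \<open>Solving x - X x = y is a fixed point problem for the contraction sending x to y + X x.
  The bound \<open>lower\<close> makes the solution unique and the solution map bounded.\<close>

lemma neumann_inverse:
  fixes X :: "'a::{real_normed_vector, complete_space} \<Rightarrow>\<^sub>L 'a"
  assumes X: "norm X < 1"
  obtains V where "(id_blinfun - X) o\<^sub>L V = id_blinfun" "V o\<^sub>L (id_blinfun - X) = id_blinfun"
proof -
  have lower: "(1 - norm X) * norm x \<le> norm (x - X x)" for x
    using norm_triangle_ineq2[of x "X x"] norm_blinfun[of X x] by (simp add: algebra_simps)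
  have "\<exists>x. x - X x = y" for y
  proof -
    have "\<exists>!x\<in>UNIV. y + X x = x"
    proof (rule Banach_fix[where c = "norm X"])
      show "\<And>x z. dist (y + X x) (y + X z) \<le> norm X * dist x z"
        by (simp add: dist_norm norm_blinfun flip: blinfun.diff_right)
    qed (use X in \<open>auto simp: complete_UNIV\<close>)
    then show ?thesis by (metis add_diff_cancel_right')
  qed
  then obtain v where v: "v y - X (v y) = y" for y by metis
  have inj: "x = z" if "x - X x = z - X z" for x z
  proof -
    have "(1 - norm X) * norm (x - z) \<le> 0"
      using lower[of "x - z"] that by (simp add: blinfun.diff_right algebra_simps)
    then show ?thesis using X by (simp add: mult_le_0_iff)
  qed
  have bl: "bounded_linear v"
  proof (rule bounded_linear_intro)
    show "v (x + y) = v x + v y" for x y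
      by (rule inj) (simp only: blinfun.add_right add_diff_add v)
    show "v (r *\<^sub>R x) = r *\<^sub>R v x" for r x
      by (rule inj) (simp only: blinfun.scaleR_right scaleR_diff_right[symmetric] v)
    show "norm (v x) \<le> norm x * (1 / (1 - norm X))" for x
      using lower[of "v x"] v[of x] X by (simp add: field_simps)
  qed
  show thesis
  proof (rule that[of "Blinfun v"])
    show "(id_blinfun - X) o\<^sub>L Blinfun v = id_blinfun"
      by (rule blinfun_eqI) (simp add: blinfun.diff_left bounded_linear_Blinfun_apply[OF bl] v)
    have "v (x - X x) = x" for x
      by (rule inj) (rule v)
    then show "Blinfun v o\<^sub>L (id_blinfun - X) = id_blinfun"
      by (intro blinfun_eqI) (simp add: blinfun.diff_left bounded_linear_Blinfun_apply[OF bl])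
  qed
qed

section \<open>Orthogonal projections\<close>

lemma closed_csubspace_subspace: "closed_csubspace N \<Longrightarrow> subspace N"
  by (simp add: closed_csubspace_def csubspace_imp_subspace)

lemma closed_csubspace_scaleC: "closed_csubspace N \<Longrightarrow> x \<in> N \<Longrightarrow> c *\<^sub>C x \<in> N"
  by (simp add: closed_csubspace_def complex_vector.subspace_scale)

lemma proj_in: "closed_csubspace N \<Longrightarrow> proj N x \<in> N"
  using is_proj_proj[of N] by (simp add: is_proj_def)

lemma proj_orth:
  assumes "closed_csubspace N" "y \<in> N"
  shows "inner (x - proj N x) y = 0"
  using is_proj_proj[OF assms(1)] assms(2) by (simp add: is_proj_def inner_eq_Re_cinner)

lemma proj_unique:
  assumes N: "closed_csubspace N" and "p \<in> N" and orth: "\<And>y. y \<in> N \<Longrightarrow> inner (x - p) y = 0"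
  shows "proj N x = p"
proof -
  have d: "proj N x - p \<in> N"
    using N assms(2) by (intro subspace_diff closed_csubspace_subspace proj_in)
  have "inner (proj N x - p) (proj N x - p) = 0"
    using orth[OF d] proj_orth[OF N d, of x] by (simp add: inner_diff_left)
  then show ?thesis by simp
qed

lemma proj_same: "closed_csubspace N \<Longrightarrow> x \<in> N \<Longrightarrow> proj N x = x"
  by (rule proj_unique) simp_all

lemma proj_eq_0:
  "closed_csubspace N \<Longrightarrow> (\<And>y. y \<in> N \<Longrightarrow> inner x y = 0) \<Longrightarrow> proj N x = 0"
  by (rule proj_unique) (simp_all add: subspace_0 closed_csubspace_subspace)

lemma proj_bounded_ops:
  assumes N: "closed_csubspace N"
  shows "proj N \<in> bounded_ops"
proof (rule bounded_opsI)
  fix c x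
  show "proj N (c *\<^sub>C x) = c *\<^sub>C proj N x"
  proof (rule proj_unique[OF N])
    show "c *\<^sub>C proj N x \<in> N"
      using N by (intro closed_csubspace_scaleC proj_in)
    show "inner (c *\<^sub>C x - c *\<^sub>C proj N x) y = 0" if "y \<in> N" for y
      using proj_orth[OF N closed_csubspace_scaleC[OF N that], of x "cnj c"]
      by (simp add: inner_scaleC_left flip: complex_vector.scale_right_diff_distrib)
  qed
qed

lemma inner_proj:
  assumes N: "closed_csubspace N"
  shows "inner (proj N x) y = inner (proj N x) (proj N y)"
  using proj_orth[OF N proj_in[OF N, of x], of y]
  by (simp add: inner_diff_left inner_commute[of "proj N x"])

lemma proj_selfadjoint:
  assumes N: "closed_csubspace N"
  shows "inner (proj N x) y = inner x (proj N y)"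
  using inner_proj[OF N, of x y] inner_proj[OF N, of y x] by (simp add: inner_commute)

lemma proj_pythagoras:
  assumes N: "closed_csubspace N" and "u \<in> N"
  shows "(norm (x - u))\<^sup>2 = (norm (x - proj N x))\<^sup>2 + (norm (proj N x - u))\<^sup>2"
proof -
  have "proj N x - u \<in> N"
    using N assms(2) by (intro subspace_diff closed_csubspace_subspace proj_in)
  from proj_orth[OF N this, of x] show ?thesis
    using norm_add_Pythagorean[of "x - proj N x" "proj N x - u"] by (simp add: orthogonal_def)
qed

lemma norm_proj_pythagoras:
  assumes N: "closed_csubspace N"
  shows "(norm x)\<^sup>2 = (norm (x - proj N x))\<^sup>2 + (norm (proj N x))\<^sup>2"
  using proj_pythagoras[OF N subspace_0[OF closed_csubspace_subspace[OF N]], of x] by simp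

lemma norm_diff_proj_le:
  assumes N: "closed_csubspace N"
  shows "norm (x - proj N x) \<le> norm x" "norm (proj N x) \<le> norm x"
  using norm_proj_pythagoras[OF N, of x] by (simp_all add: power2_le_imp_le)

text \<open>A closed subspace is its own double orthogonal complement; the component of
  \<open>x\<close> orthogonal to \<open>N\<close> is the only test vector required.\<close>

lemma in_csubspaceI_orth:
  assumes N: "closed_csubspace N" and "\<And>y. (\<And>z. z \<in> N \<Longrightarrow> inner y z = 0) \<Longrightarrow> inner x y = 0"
  shows "x \<in> N"
proof -
  have "inner x (x - proj N x) = 0" by (intro assms proj_orth)
  moreover have "inner (proj N x) (x - proj N x) = 0"
    using proj_orth[OF N proj_in[OF N]] by (simp add: inner_commute)
  ultimately have "inner (x - proj N x) (x - proj N x) = 0"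
    by (simp add: inner_diff_left)
  then show ?thesis using proj_in[OF N, of x] by simp
qed

section \<open>Parrott's theorem\<close>

text \<open>Outside \<open>N\<close> the operator is prescribed by \<open>B\<close>, so only its
  component in \<open>N\<close> has to be extended from \<open>M\<close>. For norm B < r the form
  G(x, y) = <x, y> - <B x, B y> / r^2 is positive definite, and norm A < r says that on
  \<open>M\<close> the \<open>N\<close>-component of \<open>A\<close> has square norm at most r^2 G.
  Composing this component with the \<open>G\<close>-orthogonal projection \<open>J\<close> onto
  \<open>M\<close> keeps the bound on the whole space.\<close>

lemma parrott:
  fixes A B :: "'a::complex_hilbert_space \<Rightarrow>\<^sub>L 'a"
  assumes M: "closed_csubspace M" and N: "closed_csubspace N"
    and ops: "A \<in> bounded_ops" "B \<in> bounded_ops"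
    and c: "norm A < c" "norm B < c"
    and BN: "\<And>x. proj N (B x) = 0"
    and AB: "\<And>x. x \<in> M \<Longrightarrow> A x - proj N (A x) = B x"
  obtains Y where "Y \<in> bounded_ops" "norm Y < c" "\<And>x. x \<in> M \<Longrightarrow> Y x = A x"
    "\<And>x. Y x - proj N (Y x) = B x"
proof -
  let ?P = "proj M" and ?Q = "proj N"
  \<comment> \<open>The slack below \<open>c\<close> keeps the final bound strict; the slack above
    norm B makes \<open>G\<close> coercive.\<close>
  obtain r where r: "norm A < r" "norm B < r" "r < c"
    using dense[of "max (norm A) (norm B)" c] c by auto
  have r0: "0 < r" using r(1) norm_ge_zero[of A] by linarith
  define k where "k = (norm B / r)\<^sup>2"
  have k: "0 \<le> k" "k < 1"
    using r r0 by (simp_all add: k_def power_less_one_iff)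
  \<comment> \<open>\<open>C\<close> is B* B / r^2, so that \<open>G\<close> is represented by 1 -
    C.\<close>
  obtain C :: "'a \<Rightarrow>\<^sub>L 'a" where C: "\<And>x y. inner (C x) y = inner (B x) (B y) / r\<^sup>2"
    and nC: "norm C \<le> k"
  proof (rule bounded_form_representation[of "\<lambda>x y. inner (B x) (B y) / r\<^sup>2" k])
    show "\<bar>inner (B x) (B y) / r\<^sup>2\<bar> \<le> k * norm x * norm y" for x y
    proof -
      have "\<bar>inner (B x) (B y)\<bar> \<le> norm (B x) * norm (B y)"
        by (rule Cauchy_Schwarz_ineq2)
      also have "\<dots> \<le> (norm B * norm x) * (norm B * norm y)"
        by (intro mult_mono norm_blinfun) auto
      finally show ?thesis
        using r0 by (simp add: k_def divide_simps power2_eq_square mult_ac)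
    qed
  qed (auto intro!: linearI simp: k blinfun.add_right blinfun.scaleR_right inner_add_left
      inner_add_right add_divide_distrib)
  have C_ops: "C \<in> bounded_ops"
    by (rule bounded_opsI_inner) (simp add: C bounded_ops_scaleC[OF ops(2)] inner_scaleC_left)
  \<comment> \<open>1 - X represents the restriction of \<open>G\<close> to \<open>M\<close>; its
    inverse \<open>V\<close> is what the \<open>G\<close>-orthogonal projection requires.\<close>
  define X where "X = ?P o\<^sub>L C o\<^sub>L ?P"
  have X_ops: "X \<in> bounded_ops"
    unfolding X_def by (intro bounded_ops_compose proj_bounded_ops M C_ops)
  have "norm X \<le> norm C"
  proof (rule norm_blinfun_bound)
    show "norm (X x) \<le> norm C * norm x" for x
    proof -
      have "norm (X x) \<le> norm (C (?P x))"
        by (simp add: X_def norm_diff_proj_le[OF M])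
      also have "\<dots> \<le> norm C * norm (?P x)" by (rule norm_blinfun)
      also have "\<dots> \<le> norm C * norm x"
        by (intro mult_left_mono norm_diff_proj_le[OF M]) auto
      finally show ?thesis .
    qed
  qed simp
  then have "norm X < 1" using nC k by linarith
  then obtain V where V: "(id_blinfun - X) o\<^sub>L V = id_blinfun" "V o\<^sub>L (id_blinfun - X) = id_blinfun"
    using neumann_inverse by blast
  have V1: "V y - X (V y) = y" for y
    using arg_cong[OF V(1), of "\<lambda>T. blinfun_apply T y"] by (simp add: blinfun.diff_left)
  have V2: "V (y - X y) = y" for y
    using arg_cong[OF V(2), of "\<lambda>T. blinfun_apply T y"] by (simp add: blinfun.diff_left)
  have V_ops: "V \<in> bounded_ops"
    by (rule bounded_ops_inverse[OF _ V]) (intro bounded_ops_diff bounded_ops_id X_ops)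
  \<comment> \<open>J h is the element of \<open>M\<close> for which (1 - C) (J h) and (1 - C) h
    have the same projection onto \<open>M\<close>, that is, h - J h is \<open>G\<close>-orthogonal
    to \<open>M\<close>.\<close>
  define J where "J = V o\<^sub>L ?P o\<^sub>L (id_blinfun - C)"
  have J_ops: "J \<in> bounded_ops"
    unfolding J_def
    by (intro bounded_ops_compose bounded_ops_diff bounded_ops_id proj_bounded_ops M V_ops C_ops)
  have JX: "J h = ?P (h - C h) + X (J h)" for h
    using V1[of "?P (h - C h)"] by (simp add: J_def blinfun.diff_left algebra_simps)
  have JM: "J h \<in> M" for h
    by (subst JX) (auto simp: X_def intro!: subspace_add closed_csubspace_subspace proj_in M)
  have J_same: "J m = m" if "m \<in> M" for m
    using V2[of m] that by (simp add: J_def X_def proj_same[OF M] blinfun.diff_left blinfun.diff_right)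
  define G where "G x y = inner x y - inner (B x) (B y) / r\<^sup>2" for x y
  have G_orth: "G (h - J h) m = 0" if "m \<in> M" for h m
  proof -
    have "G (h - J h) m = inner ((h - J h) - C (h - J h)) (?P m)"
      using that by (simp add: G_def inner_diff_left proj_same[OF M] flip: C)
    also have "\<dots> = inner (?P (h - C h) - (?P (J h) - ?P (C (J h)))) m"
      unfolding proj_selfadjoint[OF M, symmetric]
      by (rule arg_cong2[where f = inner]) (simp_all add: blinfun.diff_right)
    also have "?P (J h) - ?P (C (J h)) = ?P (h - C h)"
      using JX[of h] by (simp add: X_def proj_same[OF M JM] algebra_simps)
    finally show ?thesis by simp
  qed
  have G_nonneg: "0 \<le> G h h" for h
  proof -
    have "(norm (B h))\<^sup>2 \<le> (r * norm h)\<^sup>2"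
      using norm_blinfun[of B h] r(2)
      by (intro power_mono order_trans[OF norm_blinfun] mult_right_mono) auto
    then show ?thesis
      using r0 by (simp add: G_def field_simps power2_norm_eq_inner power_mult_distrib)
  qed
  have G_J: "G (J h) (J h) \<le> G h h" for h
  proof -
    \<comment> \<open>Pythagoras for \<open>G\<close>: the mixed term vanishes by
      \<open>G_orth\<close>.\<close>
    have "G h h = G (h - J h) (h - J h) + G (J h) (J h) + 2 * G (h - J h) (J h)"
      by (simp add: G_def blinfun.diff_right inner_diff_left inner_diff_right
          inner_commute algebra_simps add_divide_distrib diff_divide_distrib)
    then show ?thesis
      using G_nonneg[of "h - J h"] G_orth[OF JM, of h h] by simp
  qed
  define Y where "Y = B + (?Q o\<^sub>L A o\<^sub>L J)"
  have Y: "Y h = B h + ?Q (A (J h))" for h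
    by (simp add: Y_def blinfun.add_left)
  have QY: "?Q (Y h) = ?Q (A (J h))" for h
    by (simp add: Y blinfun.add_right BN proj_same[OF N proj_in[OF N]])
  show ?thesis
  proof (rule that)
    show "Y \<in> bounded_ops"
      unfolding Y_def
      by (intro bounded_ops_add bounded_ops_compose proj_bounded_ops ops J_ops N)
    show "Y x = A x" if "x \<in> M" for x
      using AB[OF that] by (simp add: Y J_same[OF that] diff_eq_eq)
    show YB: "Y x - ?Q (Y x) = B x" for x
      unfolding QY by (simp add: Y)
    have "norm (Y h) \<le> r * norm h" for h
    proof (rule power2_le_imp_le)
      \<comment> \<open>On \<open>M\<close> the component of \<open>A\<close> orthogonal to
        \<open>N\<close> is \<open>B\<close>, so the \<open>N\<close>-component is controlled by
        what \<open>B\<close> leaves over.\<close>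
      have "(norm (?Q (A (J h))))\<^sup>2 = (norm (A (J h)))\<^sup>2 - (norm (B (J h)))\<^sup>2"
        using norm_proj_pythagoras[OF N, of "A (J h)"] AB[OF JM] by simp
      also have "\<dots> \<le> (r * norm (J h))\<^sup>2 - (norm (B (J h)))\<^sup>2"
        using r(1) by (intro diff_right_mono power_mono order_trans[OF norm_blinfun] mult_right_mono) auto
      also have "\<dots> = r\<^sup>2 * G (J h) (J h)"
        using r0 by (simp add: G_def power_mult_distrib power2_norm_eq_inner field_simps)
      also have "\<dots> \<le> r\<^sup>2 * G h h"
        by (intro mult_left_mono G_J) simp
      also have "\<dots> = (r * norm h)\<^sup>2 - (norm (B h))\<^sup>2"
        using r0 by (simp add: G_def power_mult_distrib power2_norm_eq_inner field_simps)
      finally show "(norm (Y h))\<^sup>2 \<le> (r * norm h)\<^sup>2"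
        using norm_proj_pythagoras[OF N, of "Y h"] YB[of h] QY[of h] by simp
    qed (use r0 in simp)
    then have "norm Y \<le> r"
      using r0 by (intro norm_blinfun_bound) auto
    then show "norm Y < c" using r(3) by simp
  qed
qed

section \<open>From close nest algebras to close nests\<close>

lemma nest_closed_csubspace: "is_nest \<N> \<Longrightarrow> N \<in> \<N> \<Longrightarrow> closed_csubspace N"
  by (simp add: is_nest_def)

lemma nest_Inter: "is_nest \<N> \<Longrightarrow> \<S> \<subseteq> \<N> \<Longrightarrow> \<Inter>\<S> \<in> \<N>"
  by (simp add: is_nest_def)

lemma nest_closure_cspan: "is_nest \<N> \<Longrightarrow> \<S> \<subseteq> \<N> \<Longrightarrow> closure (cspan (\<Union>\<S>)) \<in> \<N>"
  by (simp add: is_nest_def)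

lemma nest_algebra_scaleR:
  assumes T: "T \<in> nest_algebra \<N>" and \<N>: "is_nest \<N>"
  shows "r *\<^sub>R T \<in> nest_algebra \<N>"
proof -
  have "r *\<^sub>R T \<in> bounded_ops"
  proof (rule bounded_opsI)
    have "T (c *\<^sub>C x) = c *\<^sub>C T x" for c x
      using T by (simp add: nest_algebra_def bounded_ops_def)
    then show "(r *\<^sub>R T) (c *\<^sub>C x) = c *\<^sub>C (r *\<^sub>R T) x" for c x
      by (simp add: blinfun.scaleR_left scaleC_scaleC mult.commute flip: scaleC_of_real)
  qed
  moreover have "r *\<^sub>R T x \<in> N" if "N \<in> \<N>" "x \<in> N" for N x
    using T that nest_closed_csubspace[OF \<N>]
    by (intro subspace_scale closed_csubspace_subspace) (auto simp: nest_algebra_def)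
  ultimately show ?thesis
    by (auto simp: nest_algebra_def blinfun.scaleR_left)
qed

lemma nest_algebra_zero: "is_nest \<N> \<Longrightarrow> 0 \<in> nest_algebra \<N>"
  using subspace_0[OF closed_csubspace_subspace[OF nest_closed_csubspace]]
  by (auto simp: nest_algebra_def bounded_ops_def)

lemma alg_dist_commute: "alg_dist \<A> \<B> = alg_dist \<B> \<A>"
  by (simp add: alg_dist_def max.commute norm_minus_commute)

text \<open>Rescaling to the unit ball turns the distance, a supremum of infima, into an approximant
  for every element of the algebra.\<close>

lemma alg_dist_less_approx:
  fixes \<M> \<N> :: "'a::complex_hilbert_space set set"
  assumes M: "is_nest \<M>" and N: "is_nest \<N>"
    and d: "alg_dist (nest_algebra \<M>) (nest_algebra \<N>) < d"
    and B: "B \<in> nest_algebra \<N>"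
  shows "\<exists>A\<in>nest_algebra \<M>. norm (A - B) \<le> d * norm B"
proof (cases "B = 0")
  case True
  then show ?thesis using nest_algebra_zero[OF M] by auto
next
  case False
  let ?A = "nest_algebra \<M>" and ?B = "{B \<in> nest_algebra \<N>. norm B \<le> 1}"
  let ?g = "\<lambda>B. INF A\<in>?A. norm (A - B)"
  have ne: "?A \<noteq> {}" using nest_algebra_zero[OF M] by auto
  have bdd: "bdd_below ((\<lambda>A. norm (A - B)) ` ?A)" for B
    by (rule bdd_belowI[of _ 0]) auto
  \<comment> \<open>Comparison with the operator 0 bounds the infima by 1, so the real-valued
    supremum is a genuine upper bound.\<close>
  have "?g B \<le> 1" if "norm B \<le> 1" for B
    using cINF_lower[OF bdd nest_algebra_zero[OF M], of B] that by simp
  then have bdd': "bdd_above (?g ` ?B)"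
    by (auto intro!: bdd_aboveI2[of _ _ 1])
  define B' where "B' = (1 / norm B) *\<^sub>R B"
  have "B' \<in> ?B"
    using nest_algebra_scaleR[OF B N] False by (simp add: B'_def)
  then have "?g B' \<le> (SUP B\<in>?B. ?g B)"
    by (intro cSUP_upper bdd')
  also have "\<dots> < d" using d by (simp add: alg_dist_def)
  finally obtain A where A: "A \<in> ?A" "norm (A - B') < d"
    using cINF_less_iff[OF ne bdd] by blast
  have "norm B *\<^sub>R A - B = norm B *\<^sub>R (A - B')"
    using False by (simp add: B'_def scaleR_diff_right)
  then have "norm (norm B *\<^sub>R A - B) = norm B * norm (A - B')"
    by (metis abs_norm_cancel norm_scaleR)
  then have "norm (norm B *\<^sub>R A - B) \<le> d * norm B"
    using mult_left_mono[OF less_imp_le[OF A(2)], of "norm B"] by (simp add: mult.commute)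
  then show ?thesis using nest_algebra_scaleR[OF A(1) M] by blast
qed

section \<open>Rank-one operators\<close>

definition rank_one :: "'a \<Rightarrow> 'a \<Rightarrow> ('a::complex_hilbert_space \<Rightarrow>\<^sub>L 'a)" where
  "rank_one x y = Blinfun (\<lambda>h. cinner h y *\<^sub>C x)"

lemma norm_cinner_scaleC_le: "norm (cinner h y *\<^sub>C x) \<le> norm h * (norm x * norm y)"
  using mult_right_mono[OF norm_cinner_le[of h y] norm_ge_zero[of x]]
  by (simp add: norm_scaleC mult_ac)

lemma rank_one_apply [simp]: "rank_one x y h = cinner h y *\<^sub>C x"
proof -
  have "bounded_linear (\<lambda>h. cinner h y *\<^sub>C x)"
  proof (rule bounded_linear_intro[OF _ _ norm_cinner_scaleC_le])
    show "cinner (r *\<^sub>R h) y *\<^sub>C x = r *\<^sub>R cinner h y *\<^sub>C x" for r h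
      by (simp add: cinner_scaleC_left scaleC_scaleC flip: scaleC_of_real)
  qed (simp add: cinner_add_left scaleC_add_left)
  then show ?thesis by (simp add: rank_one_def bounded_linear_Blinfun_apply)
qed

lemma norm_rank_one_le: "norm (rank_one x y) \<le> norm x * norm y"
  using norm_cinner_scaleC_le by (intro norm_blinfun_bound) (auto simp: mult.commute)

text \<open>Each \<open>N\<close> either contains the range of the operator or lies in its
  kernel.\<close>

lemma rank_one_in_nest_algebra:
  assumes \<N>: "is_nest \<N>"
    and xy: "\<And>N. N \<in> \<N> \<Longrightarrow> x \<in> N \<or> (\<forall>h\<in>N. inner y h = 0)"
  shows "rank_one x y \<in> nest_algebra \<N>"
proof -
  have "cinner h y *\<^sub>C x \<in> N" if N: "N \<in> \<N>" and h: "h \<in> N" for N h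
  proof -
    note cN = nest_closed_csubspace[OF \<N> N]
    from xy[OF N] show ?thesis
    proof
      assume "\<forall>h\<in>N. inner y h = 0"
      then have "cinner y h = 0"
        using cN cinner_zero_iff_inner[of N y] h by (simp add: closed_csubspace_def)
      then have "cinner h y = 0" using cinner_commute[of h y] by simp
      then show ?thesis using subspace_0[OF closed_csubspace_subspace[OF cN]] by simp
    qed (rule closed_csubspace_scaleC[OF cN])
  qed
  then show ?thesis
    by (auto simp: nest_algebra_def bounded_ops_def cinner_scaleC_left scaleC_scaleC)
qed

text \<open>The vector m = P y, with P the projection onto \<open>M\<close>, is sent by
  \<open>A\<close> into \<open>M\<close> but by the rank-one operator to a multiple of
  \<open>x\<close> by (norm m)^2. The component of that multiple orthogonal to \<open>M\<close> is
  therefore due to the approximation error alone; dividing by norm m gives the bound.\<close>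

lemma rank_one_approx:
  assumes \<M>: "is_nest \<M>" and M: "M \<in> \<M>"
    and A: "A \<in> nest_algebra \<M>" "norm (A - rank_one x y) \<le> d * norm (rank_one x y)"
    and d: "0 \<le> d"
  shows "norm (x - proj M x) * norm (proj M y) \<le> d * (norm x * norm y)"
proof (cases "proj M y = 0")
  case True
  then show ?thesis using d by simp
next
  case False
  note cM = nest_closed_csubspace[OF \<M> M]
  let ?m = "proj M y"
  have orth: "\<forall>h\<in>M. cinner (y - ?m) h = 0"
    using is_proj_proj[OF cM] by (simp add: is_proj_def)
  then have "cinner (y - ?m) ?m = 0" using proj_in[OF cM] by blast
  moreover have "cinner y ?m = cinner (y - ?m) ?m + cinner ?m ?m"
    by (simp flip: cinner_add_left)
  ultimately have "cinner ?m y = complex_of_real ((norm ?m)\<^sup>2)"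
    using cinner_commute[of ?m y] by (simp add: cinner_self)
  then have R: "rank_one x y ?m = (norm ?m)\<^sup>2 *\<^sub>R x"
    by (simp only: rank_one_apply scaleC_of_real)
  have "A ?m \<in> M"
    using A(1) M proj_in[OF cM] by (auto simp: nest_algebra_def)
  then have "A ?m - proj M (A ?m) = 0" by (simp add: proj_same[OF cM])
  then have "(norm ?m)\<^sup>2 *\<^sub>R (x - proj M x) =
      (rank_one x y - A) ?m - proj M ((rank_one x y - A) ?m)"
    by (simp add: blinfun.diff_left blinfun.diff_right blinfun.scaleR_right R algebra_simps
        del: rank_one_apply)
  then have "(norm ?m)\<^sup>2 * norm (x - proj M x) \<le> norm ((rank_one x y - A) ?m)"
    using norm_diff_proj_le(1)[OF cM] by (metis norm_scaleR abs_of_nonneg zero_le_power2)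
  also have "\<dots> \<le> norm (A - rank_one x y) * norm ?m"
    by (metis norm_blinfun norm_minus_commute)
  also have "\<dots> \<le> d * (norm x * norm y) * norm ?m"
    using A(2) d norm_rank_one_le[of x y]
    by (intro mult_right_mono) (auto intro: order_trans mult_left_mono)
  finally show ?thesis using False by (simp add: power2_eq_square mult_ac)
qed

text \<open>With P and Q projecting onto \<open>M\<close> and \<open>N\<close>, Q - P = (1 - P) Q -
  P (1 - Q). The two terms have orthogonal ranges and act on orthogonal components of the vector, so
  their bounds do not add up.\<close>

lemma norm_proj_diff_le:
  assumes M: "closed_csubspace M" and N: "closed_csubspace N" and s: "0 \<le> s"
    and a: "\<And>y. (\<And>z. z \<in> N \<Longrightarrow> inner y z = 0) \<Longrightarrow> norm (proj M y) \<le> s * norm y"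
    and b: "\<And>x. x \<in> N \<Longrightarrow> norm (x - proj M x) \<le> s * norm x"
  shows "norm (proj N - proj M) \<le> s"
proof (rule norm_blinfun_bound[OF s], rule power2_le_imp_le)
  fix h
  let ?x = "proj N h" and ?y = "h - proj N h"
  have "(proj N - proj M) h = (?x - proj M ?x) - proj M ?y"
    by (simp add: blinfun.diff_left blinfun.diff_right)
  moreover have "inner (?x - proj M ?x) (proj M ?y) = 0"
    by (intro proj_orth proj_in M)
  ultimately have "(norm ((proj N - proj M) h))\<^sup>2 =
      (norm (?x - proj M ?x))\<^sup>2 + (norm (proj M ?y))\<^sup>2"
    using norm_add_Pythagorean[of "?x - proj M ?x" "- proj M ?y"] by (simp add: orthogonal_def)
  also have "\<dots> \<le> (s * norm ?x)\<^sup>2 + (s * norm ?y)\<^sup>2"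
    by (intro add_mono power_mono a b proj_in proj_orth N) auto
  also have "\<dots> = (s * norm h)\<^sup>2"
    by (simp add: power_mult_distrib norm_proj_pythagoras[OF N, of h] algebra_simps)
  finally show "(norm ((proj N - proj M) h))\<^sup>2 \<le> (s * norm h)\<^sup>2" .
qed (simp add: s)

section \<open>Unions and spans of chains of subspaces\<close>

lemma subspace_closure:
  fixes S :: "'a::real_normed_vector set"
  assumes S: "subspace S"
  shows "subspace (closure S)"
  unfolding subspace_def
proof (intro conjI ballI allI)
  show "0 \<in> closure S" using subspace_0[OF S] closure_subset by blast
  show "x + y \<in> closure S" if x: "x \<in> closure S" and y: "y \<in> closure S" for x y
  proof -
    obtain f g where "\<forall>n. f n \<in> S" "f \<longlonglongrightarrow> x" "\<forall>n. g n \<in> S" "g \<longlonglongrightarrow> y"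
      using x y unfolding closure_sequential by blast
    then show ?thesis
      unfolding closure_sequential
      by (intro exI[of _ "\<lambda>n. f n + g n"]) (auto intro: tendsto_add subspace_add[OF S])
  qed
  show "c *\<^sub>R x \<in> closure S" if x: "x \<in> closure S" for c x
  proof -
    obtain f where "\<forall>n. f n \<in> S" "f \<longlonglongrightarrow> x"
      using x unfolding closure_sequential by blast
    then show ?thesis
      unfolding closure_sequential
      by (intro exI[of _ "\<lambda>n. c *\<^sub>R f n"])
        (auto intro: tendsto_scaleR tendsto_const subspace_scale[OF S])
  qed
qed

lemma subspace_Union_chain:
  assumes "\<S> \<noteq> {}" "\<And>N. N \<in> \<S> \<Longrightarrow> subspace N"
    and chain: "\<And>M N. M \<in> \<S> \<Longrightarrow> N \<in> \<S> \<Longrightarrow> M \<subseteq> N \<or> N \<subseteq> M"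
  shows "subspace (\<Union>\<S>)"
  unfolding subspace_def
proof (intro conjI ballI allI)
  show "x + y \<in> \<Union>\<S>" if xy: "x \<in> \<Union>\<S>" "y \<in> \<Union>\<S>" for x y
  proof -
    obtain M N where "M \<in> \<S>" "N \<in> \<S>" "x \<in> M" "y \<in> N" using xy by blast
    then obtain K where "K \<in> \<S>" "x \<in> K" "y \<in> K" using chain[of M N] by blast
    then show ?thesis using subspace_add[OF assms(2)] by blast
  qed
  show "0 \<in> \<Union>\<S>" using assms(1,2) subspace_0 by blast
  show "c *\<^sub>R x \<in> \<Union>\<S>" if "x \<in> \<Union>\<S>" for c x
    using that subspace_scale[OF assms(2)] by blast
qed

text \<open>Lets the closed span of members of a nest be treated as the closure of their union, so
  that closed conditions pass to it.\<close>

lemma cspan_Union_chain: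
  fixes \<S> :: "'a::complex_hilbert_space set set"
  assumes "\<S> \<noteq> {}" "\<And>N. N \<in> \<S> \<Longrightarrow> closed_csubspace N"
    and "\<And>M N. M \<in> \<S> \<Longrightarrow> N \<in> \<S> \<Longrightarrow> M \<subseteq> N \<or> N \<subseteq> M"
  shows "cspan (\<Union>\<S>) = \<Union>\<S>"
proof -
  have "subspace (\<Union>\<S>)"
    using assms closed_csubspace_subspace by (intro subspace_Union_chain) blast+
  then have "csubspace (\<Union>\<S>)"
    using closed_csubspace_scaleC[OF assms(2)]
    by (auto simp: complex_vector.subspace_def subspace_def)
  then show ?thesis by (rule complex_vector.span_eq_iff[THEN iffD2])
qed

text \<open>
  Call \<open>N\<close> small if it is almost contained in \<open>M\<close> and large if its complement is almost
  orthogonal to \<open>M\<close>.  The span \<open>N0\<close> of the small members is small and the intersection \<open>N1\<close> of the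
  large ones is large.  Every member is small or large, so the nest algebra contains all
  rank-one operators from the complement of \<open>N0\<close> to \<open>N1\<close>; approximating these shows that \<open>N0\<close> is
  large or \<open>N1\<close> is small.
\<close>

lemma exists_close_nest_member:
  fixes \<M> \<N> :: "'a::complex_hilbert_space set set"
  assumes \<M>: "is_nest \<M>" and \<N>: "is_nest \<N>" and M: "M \<in> \<M>" and s: "0 \<le> s"
    and approx: "\<And>B. B \<in> nest_algebra \<N> \<Longrightarrow> \<exists>A\<in>nest_algebra \<M>. norm (A - B) \<le> s\<^sup>2 * norm B"
  shows "\<exists>N\<in>\<N>. norm (proj N - proj M) \<le> s"
proof -
  note cM = nest_closed_csubspace[OF \<M> M] and cN = nest_closed_csubspace[OF \<N>]
  have chain: "N \<subseteq> N' \<or> N' \<subseteq> N" if "N \<in> \<N>" "N' \<in> \<N>" for N N'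
    using \<N> that by (simp add: is_nest_def)
  define orth where "orth N = {y. \<forall>z\<in>N. inner y z = 0}" for N :: "'a set"
  define small where "small N \<longleftrightarrow> (\<forall>x\<in>N. norm (x - proj M x) \<le> s * norm x)" for N
  define large where "large N \<longleftrightarrow> (\<forall>y\<in>orth N. norm (proj M y) \<le> s * norm y)" for N
  have orth_subspace: "subspace (orth N)" for N
    by (auto simp: subspace_def orth_def inner_add_left)
  \<comment> \<open>If both alternatives failed, witnesses \<open>x\<close> and \<open>y\<close>
    would give a rank-one operator in the algebra of \<open>\<N>\<close> whose approximation
    contradicts the product bound s^2.\<close>
  have small_or_large: "small K \<or> large L"
    if "\<And>x y N. \<lbrakk>N \<in> \<N>; x \<in> K; y \<in> orth L\<rbrakk> \<Longrightarrow> x \<in> N \<or> y \<in> orth N" for K L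
  proof (rule ccontr)
    assume "\<not> ?thesis"
    then obtain x y where x: "x \<in> K" "s * norm x < norm (x - proj M x)"
      and y: "y \<in> orth L" "s * norm y < norm (proj M y)"
      by (auto simp: small_def large_def not_le)
    have "rank_one x y \<in> nest_algebra \<N>"
      using that[OF _ x(1) y(1)] by (intro rank_one_in_nest_algebra \<N>) (auto simp: orth_def)
    from approx[OF this] have "norm (x - proj M x) * norm (proj M y) \<le> s\<^sup>2 * (norm x * norm y)"
      using rank_one_approx[OF \<M> M] by auto
    moreover have "(s * norm x) * (s * norm y) < norm (x - proj M x) * norm (proj M y)"
      using x(2) y(2) s by (intro mult_strict_mono') auto
    ultimately show False by (simp add: power2_eq_square mult_ac)
  qed
  have orth_mono: "orth N' \<subseteq> orth N" if "N \<subseteq> N'" for N N'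
    using that by (auto simp: orth_def)
  have dichotomy: "small N \<or> large N" if "N \<in> \<N>" for N
  proof (rule small_or_large)
    show "x \<in> N' \<or> y \<in> orth N'" if "N' \<in> \<N>" "x \<in> N" "y \<in> orth N" for x y N'
      using chain[OF \<open>N \<in> \<N>\<close> that(1)] that orth_mono by blast
  qed
  let ?S = "{N \<in> \<N>. small N}" and ?L = "{N \<in> \<N>. large N}"
  define N0 where "N0 = closure (\<Union>?S)"
  define N1 where "N1 = \<Inter>?L"
  have "{0} \<in> ?S" "UNIV \<in> ?L"
    using \<N> by (auto simp: is_nest_def small_def large_def orth_def)
  then have ne: "?S \<noteq> {}" "?L \<noteq> {}" by blast+
  have cspan: "cspan (\<Union>?S) = \<Union>?S"
    using ne(1) chain cN by (intro cspan_Union_chain) auto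
  have N01: "N0 \<in> \<N>" "N1 \<in> \<N>"
    using nest_closure_cspan[OF \<N>, of ?S] nest_Inter[OF \<N>, of ?L]
    unfolding cspan N0_def N1_def by auto
  have small_N0: "small N0"
  proof -
    have "closed {x. norm (x - proj M x) \<le> s * norm x}"
      by (intro closed_Collect_le continuous_intros)
    then have "N0 \<subseteq> {x. norm (x - proj M x) \<le> s * norm x}"
      unfolding N0_def by (intro closure_minimal) (auto simp: small_def)
    then show ?thesis by (auto simp: small_def)
  qed
  have large_N1: "large N1"
  proof -
    \<comment> \<open>The complement of the intersection \<open>N1\<close> is the closure of the
      union of the complements of the large members, where the closed estimate persists.\<close>
    define U where "U = closure (\<Union>(orth ` ?L))"
    have "closed {y. norm (proj M y) \<le> s * norm y}"
      by (intro closed_Collect_le continuous_intros)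
    then have U: "U \<subseteq> {y. norm (proj M y) \<le> s * norm y}"
      unfolding U_def by (intro closure_minimal) (auto simp: large_def)
    have "subspace (\<Union>(orth ` ?L))"
    proof (rule subspace_Union_chain)
      show "K \<subseteq> K' \<or> K' \<subseteq> K" if KK: "K \<in> orth ` ?L" "K' \<in> orth ` ?L" for K K'
      proof -
        obtain N N' where "N \<in> \<N>" "N' \<in> \<N>" "K = orth N" "K' = orth N'"
          using KK by blast
        then show ?thesis using chain[of N N'] orth_mono by blast
      qed
    qed (use ne(2) orth_subspace in blast)+
    then have subU: "subspace U" unfolding U_def by (rule subspace_closure)
    have "y \<in> U" if y: "y \<in> orth N1" for y
    proof -
      obtain p where p: "p \<in> U" "\<And>z. z \<in> U \<Longrightarrow> inner (y - p) z = 0"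
        using nearest_point_exists[OF subU, of y] by (auto simp: U_def)
      \<comment> \<open>y - p is orthogonal to every complement in \<open>U\<close>, hence lies in
        every large member and so in \<open>N1\<close>; since \<open>y\<close> and \<open>p\<close>
        are orthogonal to \<open>N1\<close>, it vanishes.\<close>
      have "y - p \<in> N" if N: "N \<in> ?L" for N
      proof (rule in_csubspaceI_orth)
        show "inner (y - p) z = 0" if "\<And>w. w \<in> N \<Longrightarrow> inner z w = 0" for z
          using that N closure_subset[of "\<Union>(orth ` ?L)"]
          by (intro p(2)) (auto simp: U_def orth_def)
      qed (use N cN in blast)
      then have yp: "y - p \<in> N1" by (simp add: N1_def)
      have "U \<subseteq> orth N1"
      proof -
        have "closed (orth N1)"
          unfolding orth_def Ball_def
          by (intro closed_Collect_all closed_Collect_imp open_Collect_const closed_Collect_eq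
              continuous_intros)
        then show ?thesis
          unfolding U_def by (intro closure_minimal) (auto simp: orth_def N1_def)
      qed
      then have "inner p (y - p) = 0" "inner y (y - p) = 0"
        using p(1) y yp by (auto simp: orth_def)
      then have "inner (y - p) (y - p) = 0" by (simp add: inner_diff_left)
      then show ?thesis using p(1) by simp
    qed
    then show ?thesis using U by (auto simp: large_def)
  qed
  have "small N1 \<or> large N0"
  proof (rule small_or_large)
    show "x \<in> N \<or> y \<in> orth N" if N: "N \<in> \<N>" and "x \<in> N1" "y \<in> orth N0" for x y N
    proof -
      \<comment> \<open>No member of the nest lies strictly between \<open>N0\<close> and
        \<open>N1\<close>.\<close>
      from dichotomy[OF N] have "N \<subseteq> N0 \<or> N1 \<subseteq> N"
        using N closure_subset[of "\<Union>?S"] by (auto simp: N0_def N1_def)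
      then show ?thesis using that orth_mono by blast
    qed
  qed
  then obtain N where N: "N \<in> \<N>" "small N" "large N"
    using N01 small_N0 large_N1 by blast
  have "norm (proj N - proj M) \<le> s"
    using N(2,3) by (intro norm_proj_diff_le cM cN N(1) s) (auto simp: small_def large_def orth_def)
  then show ?thesis using N(1) by blast
qed

section \<open>Pairs of close subspaces\<close>

lemma proj_close_inj:
  assumes M: "closed_csubspace M" and close: "norm (proj N - proj M) < 1"
    and x: "x \<in> M" "proj N x = 0"
  shows "x = 0"
proof -
  have "norm x = norm ((proj N - proj M) x)"
    using x by (simp add: blinfun.diff_left proj_same[OF M])
  also have "\<dots> \<le> norm (proj N - proj M) * norm x" by (rule norm_blinfun)
  finally have "(1 - norm (proj N - proj M)) * norm x \<le> 0" by (simp add: algebra_simps)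
  then show ?thesis using close by (simp add: mult_le_0_iff)
qed

text \<open>The lower bound makes the image closed, and \<open>orth\<close> leaves no room for a
  complement inside \<open>N\<close>.\<close>

lemma image_eq_if_bounded_below:
  fixes S :: "'a::complex_hilbert_space \<Rightarrow>\<^sub>L 'a"
  assumes M: "closed_csubspace M" and N: "closed_csubspace N"
    and sub: "\<And>x. x \<in> M \<Longrightarrow> S x \<in> N"
    and e: "0 < e" and below: "\<And>x. x \<in> M \<Longrightarrow> e * norm x \<le> norm (S x)"
    and orth: "\<And>z. \<lbrakk>z \<in> N; \<And>x. x \<in> M \<Longrightarrow> inner z (S x) = 0\<rbrakk> \<Longrightarrow> z = 0"
  shows "S ` M = N"
proof
  note subM = closed_csubspace_subspace[OF M]
  have "complete M"
    using M by (simp add: closed_csubspace_def complete_eq_closed)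
  then have "complete (S ` M)"
    using below by (intro complete_isometric_image[OF e subM] blinfun.bounded_linear_right) auto
  then have cl: "closed (S ` M)" by (simp add: complete_eq_closed)
  have subSM: "subspace (S ` M)"
    using blinfun.bounded_linear_right[of S] subM
    by (intro linear_subspace_image bounded_linear.linear)
  show "N \<subseteq> S ` M"
  proof
    fix z assume z: "z \<in> N"
    obtain p where p: "p \<in> S ` M" "\<forall>y\<in>S ` M. inner (z - p) y = 0"
      using nearest_point_exists[OF subSM cl] by blast
    have "z - p = 0"
      using p sub z by (intro orth subspace_diff[OF closed_csubspace_subspace[OF N]]) auto
    then show "z \<in> S ` M" using p(1) by simp
  qed
qed (use sub in auto)

text \<open>A vector of \<open>N\<close> orthogonal to the image is orthogonal to \<open>M\<close>,
  so it vanishes by \<open>proj_close_inj\<close> with the roles exchanged.\<close>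

lemma proj_close_image:
  assumes M: "closed_csubspace M" and N: "closed_csubspace N"
    and close: "norm (proj N - proj M) < 1"
  shows "proj N ` M = N"
proof (rule image_eq_if_bounded_below[OF M N, where e = "1 - norm (proj N - proj M)"])
  show "(1 - norm (proj N - proj M)) * norm x \<le> norm (proj N x)" if "x \<in> M" for x
    using norm_blinfun[of "proj N - proj M" x] norm_triangle_ineq2[of x "proj N x"]
    by (simp add: blinfun.diff_left proj_same[OF M that] norm_minus_commute algebra_simps)
  show "z = 0" if z: "z \<in> N" and orth: "\<And>x. x \<in> M \<Longrightarrow> inner z (proj N x) = 0" for z
  proof (rule proj_close_inj[OF N _ z])
    show "norm (proj M - proj N) < 1" using close by (simp add: norm_minus_commute)
    show "proj M z = 0"
      using orth by (intro proj_eq_0 M) (simp add: proj_same[OF N z] flip: proj_selfadjoint[OF N])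
  qed
qed (use close proj_in[OF N] in auto)

lemma proj_proj_subset:
  assumes "closed_csubspace M" "closed_csubspace N" "M \<subseteq> N"
  shows "proj M (proj N x) = proj M x"
proof -
  have "proj M (x - proj N x) = 0"
    using assms by (intro proj_eq_0 proj_orth) auto
  then show ?thesis by (simp add: blinfun.diff_right)
qed

text \<open>Makes proximity between nests order preserving, and, for equal \<open>M1\<close> and
  \<open>M2\<close>, single-valued.\<close>

lemma proj_close_mono:
  assumes M: "closed_csubspace M1" "closed_csubspace M2"
    and N: "closed_csubspace N1" "closed_csubspace N2"
    and close: "norm (proj N1 - proj M1) < 1" "norm (proj N2 - proj M2) < 1"
    and "M1 \<subseteq> M2" and chain: "N1 \<subseteq> N2 \<or> N2 \<subseteq> N1"
  shows "N1 \<subseteq> N2"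
proof (cases "N1 \<subseteq> N2")
  case False
  with chain have sub: "N2 \<subseteq> N1" by blast
  show ?thesis
  proof
    \<comment> \<open>Some \<open>z\<close> in the smaller space \<open>N2\<close> has the same
      projection onto \<open>M1\<close> as \<open>y\<close>; that projection is injective on
      \<open>N1\<close>, so z = y.\<close>
    fix y assume y: "y \<in> N1"
    have "proj M1 y \<in> M2" using proj_in[OF M(1)] \<open>M1 \<subseteq> M2\<close> by blast
    moreover have "proj M2 ` N2 = M2"
      using close(2) by (intro proj_close_image M N) (simp add: norm_minus_commute)
    ultimately obtain z where z: "z \<in> N2" "proj M2 z = proj M1 y" by force
    have "proj M1 z = proj M1 y"
      using proj_proj_subset[OF M \<open>M1 \<subseteq> M2\<close>, of z] z(2) by (simp add: proj_same[OF M(1) proj_in[OF M(1)]])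
    then have *: "proj M1 (z - y) = 0" by (simp add: blinfun.diff_right)
    have "z - y \<in> N1"
      using subspace_diff[OF closed_csubspace_subspace[OF N(1)]] y z(1) sub by blast
    then have "z - y = 0"
      using proj_close_inj[OF N(1) _ _ *] close(1) by (simp add: norm_minus_commute)
    then show "y \<in> N2" using z(1) by simp
  qed
qed simp

text \<open>Let \<open>z\<close> in \<open>N\<close> be orthogonal to the image, z = Q x with
  \<open>x\<close> in \<open>M\<close> and Q the projection onto \<open>N\<close>, and w = x - Y x.
  As \<open>w\<close> lies in \<open>N\<close> and is orthogonal to \<open>z\<close>, Pythagoras
  gives (norm (Y x))^2 = (norm x)^2 + (norm w)^2, which forces x = 0 because norm Y < 1.\<close>

lemma perturbed_identity_image:
  fixes Y :: "'a::complex_hilbert_space \<Rightarrow>\<^sub>L 'a"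
  assumes M: "closed_csubspace M" and N: "closed_csubspace N"
    and close: "norm (proj N - proj M) < 1"
    and Y: "norm Y < 1" "\<And>x. x \<in> M \<Longrightarrow> x - Y x \<in> N"
  shows "(id_blinfun - Y) ` M = N"
proof (rule image_eq_if_bounded_below[OF M N, where e = "1 - norm Y"])
  have S: "(id_blinfun - Y) x = x - Y x" for x
    by (simp add: blinfun.diff_left)
  show "(1 - norm Y) * norm x \<le> norm ((id_blinfun - Y) x)" for x
    using norm_blinfun[of Y x] norm_triangle_ineq2[of x "Y x"] by (simp add: S algebra_simps)
  show "z = 0" if z: "z \<in> N" and orth: "\<And>x. x \<in> M \<Longrightarrow> inner z ((id_blinfun - Y) x) = 0" for z
  proof -
    have "z \<in> proj N ` M"
      by (simp only: proj_close_image[OF M N close] z)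
    then obtain x where x: "x \<in> M" "proj N x = z" by blast
    define w where "w = x - Y x"
    have "(norm (x - w))\<^sup>2 \<le> (norm Y * norm x)\<^sup>2"
      unfolding w_def by (intro power_mono) (simp_all add: norm_blinfun)
    moreover have "(norm (x - w))\<^sup>2 = (norm (x - z))\<^sup>2 + (norm (z - w))\<^sup>2"
      using proj_pythagoras[OF N Y(2)[OF x(1)], of x] by (simp add: x(2) w_def)
    moreover have "(norm x)\<^sup>2 = (norm (x - z))\<^sup>2 + (norm z)\<^sup>2"
      using norm_proj_pythagoras[OF N, of x] by (simp add: x(2))
    moreover have "inner z w = 0" using orth[OF x(1)] by (simp add: S w_def)
    then have "(norm (z - w))\<^sup>2 = (norm z)\<^sup>2 + (norm w)\<^sup>2"
      using norm_add_Pythagorean[of z "- w"] by (simp add: orthogonal_def)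
    ultimately have "(norm (x - z))\<^sup>2 + (norm z)\<^sup>2 \<le> (norm Y)\<^sup>2 * ((norm (x - z))\<^sup>2 + (norm z)\<^sup>2)"
      by (simp add: power_mult_distrib)
         (use zero_le_power2[of "norm w"] in linarith)
    then have "(1 - (norm Y)\<^sup>2) * ((norm (x - z))\<^sup>2 + (norm z)\<^sup>2) \<le> 0"
      by (simp add: algebra_simps)
    moreover have "0 < 1 - (norm Y)\<^sup>2"
      using Y(1) by (simp add: power_less_one_iff)
    ultimately have "(norm (x - z))\<^sup>2 + (norm z)\<^sup>2 \<le> 0"
      by (simp add: mult_le_0_iff)
    then show "z = 0" by (simp add: add_nonneg_eq_0_iff order.antisym sum_power2_le_zero_iff)
  qed
qed (use Y in \<open>auto simp: blinfun.diff_left\<close>)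

section \<open>Interpolation along a nest\<close>

text \<open>Induction removes the largest member \<open>K\<close>. The condition at \<open>K\<close>
  prescribes the component of \<open>Y\<close> orthogonal to \<open>\<theta> K\<close> on
  \<open>K\<close>, while keeping the old operator \<open>A\<close> on the next largest member
  \<open>L\<close> preserves all other conditions. \<open>parrott\<close> meets both demands without
  raising the bound \<open>c\<close>.\<close>

lemma finite_chain_interpolation:
  fixes F :: "'a::complex_hilbert_space set set"
  assumes "finite F" "0 < c"
    and "\<And>M. M \<in> F \<Longrightarrow> closed_csubspace M" "\<And>M. M \<in> F \<Longrightarrow> closed_csubspace (\<theta> M)"
    and "\<And>M M'. \<lbrakk>M \<in> F; M' \<in> F\<rbrakk> \<Longrightarrow> M \<subseteq> M' \<or> M' \<subseteq> M"
    and "\<And>M M'. \<lbrakk>M \<in> F; M' \<in> F; M \<subseteq> M'\<rbrakk> \<Longrightarrow> \<theta> M \<subseteq> \<theta> M'"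
    and "\<And>M. M \<in> F \<Longrightarrow> norm (proj (\<theta> M) - proj M) < c"
  shows "\<exists>Y\<in>bounded_ops. norm Y < c \<and> (\<forall>M\<in>F. \<forall>x\<in>M. x - blinfun_apply Y x \<in> \<theta> M)"
  using assms
proof (induction "card F" arbitrary: F)
  case 0
  then show ?case by (intro bexI[of _ 0]) (auto simp: bounded_ops_def)
next
  case (Suc n)
  then have "F \<noteq> {}" by auto
  then obtain K where K: "K \<in> F" "\<And>M. M \<in> F \<Longrightarrow> M \<subseteq> K"
    using finite_has_maximal[OF Suc.prems(1)] Suc.prems(5) by (metis subset_antisym)
  define F' where "F' = F - {K}"
  have F': "F' \<subseteq> F" "finite F'" "n = card F'"
    using Suc.hyps(2) Suc.prems(1) K(1) by (auto simp: F'_def)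
  have "\<exists>Y\<in>bounded_ops. norm Y < c \<and> (\<forall>M\<in>F'. \<forall>x\<in>M. x - blinfun_apply Y x \<in> \<theta> M)"
    using F'(1) by (intro Suc.hyps(1) F' Suc.prems) auto
  then obtain A where A: "A \<in> bounded_ops" "norm A < c"
    and AF': "\<And>M x. M \<in> F' \<Longrightarrow> x \<in> M \<Longrightarrow> x - A x \<in> \<theta> M"
    by blast
  note cK = Suc.prems(3)[OF K(1)] and c\<theta>K = Suc.prems(4)[OF K(1)]
  obtain L where L: "closed_csubspace L" "L \<subseteq> K" "\<And>M. M \<in> F' \<Longrightarrow> M \<subseteq> L"
    and AL: "\<And>x. x \<in> L \<Longrightarrow> x - A x \<in> \<theta> K"
  proof (cases "F' = {}")
    case True
    \<comment> \<open>Without further members the old operator is kept only on the zero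
      subspace.\<close>
    show ?thesis
    proof (rule that[of "{0}"])
      show "closed_csubspace {0::'a}"
        by (simp add: closed_csubspace_def)
    qed (use True subspace_0[OF closed_csubspace_subspace] cK c\<theta>K in auto)
  next
    case False
    then obtain L where L: "L \<in> F'" "\<And>M. M \<in> F' \<Longrightarrow> M \<subseteq> L"
      using finite_has_maximal[OF F'(2)] Suc.prems(5) F'(1) by (metis subset_antisym subsetD)
    have "L \<in> F" using L(1) F'(1) by blast
    then show ?thesis
      using L Suc.prems(3) Suc.prems(6)[of L K] K AF'[OF L(1)] by (intro that[of L]) auto
  qed
  \<comment> \<open>The prescribed component, extended by 0 to the complement of \<open>K\<close>;
    its norm is at most that of the difference of the two projections.\<close>
  define B where "B = (id_blinfun - proj (\<theta> K)) o\<^sub>L proj K"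
  have B: "B x = proj K x - proj (\<theta> K) (proj K x)" for x
    by (simp add: B_def blinfun.diff_left)
  have "norm B \<le> norm (proj (\<theta> K) - proj K)"
  proof (rule norm_blinfun_bound)
    fix x
    have "norm (B x) = norm ((proj (\<theta> K) - proj K) (proj K x))"
      by (simp add: B blinfun.diff_left proj_same[OF cK proj_in[OF cK]] norm_minus_commute)
    also have "\<dots> \<le> norm (proj (\<theta> K) - proj K) * norm (proj K x)"
      by (rule norm_blinfun)
    also have "\<dots> \<le> norm (proj (\<theta> K) - proj K) * norm x"
      by (intro mult_left_mono norm_diff_proj_le cK) simp
    finally show "norm (B x) \<le> norm (proj (\<theta> K) - proj K) * norm x" .
  qed simp
  then have "norm B < c" using Suc.prems(7)[OF K(1)] by simp
  moreover have "B \<in> bounded_ops"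
    unfolding B_def
    by (intro bounded_ops_compose bounded_ops_diff bounded_ops_id proj_bounded_ops cK c\<theta>K)
  moreover have "proj (\<theta> K) (B x) = 0" for x
    by (simp add: B blinfun.diff_right proj_same[OF c\<theta>K proj_in[OF c\<theta>K]])
  \<comment> \<open>Compatibility of the two prescriptions on \<open>L\<close>: \<open>x\<close> and
    \<open>A x\<close> differ by an element of \<open>\<theta> K\<close>.\<close>
  moreover have "A x - proj (\<theta> K) (A x) = B x" if "x \<in> L" for x
    using proj_same[OF c\<theta>K AL[OF that]] L(2) that
    by (auto simp: B proj_same[OF cK] blinfun.diff_right algebra_simps)
  ultimately obtain Y where Y: "Y \<in> bounded_ops" "norm Y < c" "\<And>x. x \<in> L \<Longrightarrow> Y x = A x"
    "\<And>x. Y x - proj (\<theta> K) (Y x) = B x"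
    using parrott[OF L(1) c\<theta>K A(1) _ A(2)] by blast
  have "x - Y x \<in> \<theta> M" if "M \<in> F" "x \<in> M" for M x
  proof (cases "M = K")
    case True
    then have "x - Y x = proj (\<theta> K) (x - Y x)"
      using Y(4)[of x] that by (simp add: B proj_same[OF cK] blinfun.diff_right algebra_simps)
    then show ?thesis using proj_in[OF c\<theta>K] True by metis
  next
    case False
    then have M: "M \<in> F'" using that by (simp add: F'_def)
    then have "Y x = A x" using that L(3) Y(3) by blast
    then show ?thesis using AF'[OF M that(2)] by simp
  qed
  then show ?case using Y(1,2) by blast
qed

text \<open>
  The operators of norm at most \<open>c\<close>, viewed as sesquilinear forms, are a closed subset of a
  product of compact intervals.
\<close>

lemma interpolation_compactness:
  fixes \<M> :: "'a::complex_hilbert_space set set"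
  assumes c: "0 \<le> c" and cl: "\<And>M. M \<in> \<M> \<Longrightarrow> closed_csubspace (\<theta> M)"
    and fin: "\<And>F. \<lbrakk>finite F; F \<subseteq> \<M>\<rbrakk> \<Longrightarrow>
      \<exists>Y\<in>bounded_ops. norm Y \<le> c \<and> (\<forall>M\<in>F. \<forall>x\<in>M. x - blinfun_apply Y x \<in> \<theta> M)"
  shows "\<exists>Y\<in>bounded_ops. norm Y \<le> c \<and> (\<forall>M\<in>\<M>. \<forall>x\<in>M. x - blinfun_apply Y x \<in> \<theta> M)"
proof -
  define K where "K = PiE UNIV (\<lambda>p::'a \<times> 'a. cball (0::real) (c * norm (fst p) * norm (snd p)))"
  \<comment> \<open>The last clause of \<open>L\<close> encodes complex linearity. Each clause
    involves finitely many coordinates, so \<open>L\<close> is closed under pointwise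
    limits.\<close>
  define L :: "('a \<times> 'a \<Rightarrow> real) set" where "L =
    {f. (\<forall>x x' y. f (x + x', y) = f (x, y) + f (x', y)) \<and> (\<forall>r x y. f (r *\<^sub>R x, y) = r * f (x, y)) \<and>
        (\<forall>x y y'. f (x, y + y') = f (x, y) + f (x, y')) \<and> (\<forall>r x y. f (x, r *\<^sub>R y) = r * f (x, y)) \<and>
        (\<forall>a x y. f (a *\<^sub>C x, y) = f (x, cnj a *\<^sub>C y))}"
  \<comment> \<open>The requirement x - Y x \<in> \<theta> M in weak form, tested against vectors
    orthogonal to \<open>\<theta> M\<close>.\<close>
  define C :: "'a set \<Rightarrow> ('a \<times> 'a \<Rightarrow> real) set" where "C M =
    {f. \<forall>x y. x \<in> M \<and> (\<forall>z\<in>\<theta> M. inner y z = 0) \<longrightarrow> f (x, y) = inner x y}" for M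
  have "compactin (product_topology (\<lambda>_. euclidean) UNIV) K"
    unfolding K_def by (subst compactin_PiE) simp
  then have "compact K"
    by (simp add: euclidean_product_topology)
  moreover have "closed L"
    unfolding L_def
    by (intro closed_Collect_conj closed_Collect_all closed_Collect_eq continuous_intros
        continuous_on_product_coordinates)
  ultimately have "compact (K \<inter> L)" by (rule compact_Int_closed)
  moreover have "closed (C M)" for M
    unfolding C_def
    by (intro closed_Collect_all closed_Collect_imp open_Collect_const closed_Collect_eq
        continuous_on_const continuous_on_product_coordinates)
  moreover have "K \<inter> L \<inter> (\<Inter>M\<in>F. C M) \<noteq> {}" if F: "finite F" "F \<subseteq> \<M>" for F
  proof -
    obtain Y where Y: "Y \<in> bounded_ops" "norm Y \<le> c"
      "\<And>M x. M \<in> F \<Longrightarrow> x \<in> M \<Longrightarrow> x - blinfun_apply Y x \<in> \<theta> M"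
      using fin[OF F] by blast
    define f where "f = (\<lambda>(x, y). inner (Y x) y)"
    have "\<bar>inner (Y x) y\<bar> \<le> c * norm x * norm y" for x y
    proof -
      have "\<bar>inner (Y x) y\<bar> \<le> norm (Y x) * norm y" by (rule Cauchy_Schwarz_ineq2)
      also have "\<dots> \<le> (c * norm x) * norm y"
        using Y(2) by (intro mult_right_mono order_trans[OF norm_blinfun]) auto
      finally show ?thesis .
    qed
    then have "f \<in> K" by (auto simp: K_def f_def)
    moreover have "f \<in> L"
      by (auto simp: L_def f_def blinfun.add_right blinfun.scaleR_right inner_add_left
          inner_add_right bounded_ops_scaleC[OF Y(1)] inner_scaleC_left)
    moreover have "f \<in> C M" if M: "M \<in> F" for M
    proof -
      have "inner (Y x) y = inner x y" if "x \<in> M" "\<forall>z\<in>\<theta> M. inner y z = 0" for x y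
        using Y(3)[OF M that(1)] that(2)
        by (metis eq_iff_diff_eq_0 inner_commute inner_diff_right)
      then show ?thesis by (auto simp: C_def f_def)
    qed
    ultimately show ?thesis by blast
  qed
  ultimately have "K \<inter> L \<inter> (\<Inter>M\<in>\<M>. C M) \<noteq> {}"
    by (rule compact_imp_fip_image)
  then obtain f where f: "f \<in> K" "f \<in> L" "\<And>M. M \<in> \<M> \<Longrightarrow> f \<in> C M" by blast
  obtain Y where Y: "\<And>x y. inner (blinfun_apply Y x) y = f (x, y)" "norm Y \<le> c"
  proof (rule bounded_form_representation[of "\<lambda>x y. f (x, y)" c])
    show "linear (\<lambda>x. f (x, y))" "linear (\<lambda>y. f (x, y))" for x y
      using f(2) by (auto intro!: linearI simp: L_def)
    show "\<bar>f (x, y)\<bar> \<le> c * norm x * norm y" for x y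
      using f(1) by (auto simp: K_def dest: PiE_mem[where x = "(x, y)"])
  qed (use c in auto)
  have "Y \<in> bounded_ops"
    using f(2) by (intro bounded_opsI_inner) (simp add: Y(1) L_def)
  moreover have "x - Y x \<in> \<theta> M" if M: "M \<in> \<M>" and x: "x \<in> M" for M x
  proof (rule in_csubspaceI_orth[OF cl[OF M]])
    fix y assume "\<And>z. z \<in> \<theta> M \<Longrightarrow> inner y z = 0"
    then show "inner (x - Y x) y = 0"
      using f(3)[OF M] x by (simp add: inner_diff_left Y(1) C_def)
  qed
  ultimately show ?thesis using Y(2) by blast
qed

section \<open>Similarity\<close>

text \<open>One inclusion suffices: the other follows by exchanging \<open>S\<close> with
  \<open>S'\<close> and the two nests.\<close>

lemma nest_algebra_conjugate:
  assumes ops: "S \<in> bounded_ops" "S' \<in> bounded_ops"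
    and inv: "S' o\<^sub>L S = id_blinfun"
    and nests: "{blinfun_apply S ` M | M. M \<in> \<M>} = \<N>"
    and T: "T \<in> nest_algebra \<M>"
  shows "S o\<^sub>L T o\<^sub>L S' \<in> nest_algebra \<N>"
proof -
  have inv': "S' (S x) = x" for x
    using arg_cong[OF inv, of "\<lambda>T. blinfun_apply T x"] by simp
  have "S (T (S' y)) \<in> N" if N: "N \<in> \<N>" and y: "y \<in> N" for N y
  proof -
    obtain M where M: "M \<in> \<M>" "N = S ` M" using N nests by blast
    then obtain x where "x \<in> M" "y = S x" using y by blast
    moreover have "T ` M \<subseteq> M" using T M(1) by (simp add: nest_algebra_def)
    ultimately show ?thesis using M(2) inv' by auto
  qed
  moreover have "S o\<^sub>L T o\<^sub>L S' \<in> bounded_ops"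
    using T by (intro bounded_ops_compose ops) (simp add: nest_algebra_def)
  ultimately show ?thesis by (auto simp: nest_algebra_def)
qed

lemma close_nests_similar:
  fixes \<M> \<N> :: "'a::complex_hilbert_space set set"
  assumes \<M>: "is_nest \<M>" and \<N>: "is_nest \<N>" and s: "0 \<le> s" "s < 1"
    and close: "\<And>M. M \<in> \<M> \<Longrightarrow> \<exists>N\<in>\<N>. norm (proj N - proj M) \<le> s"
      "\<And>N. N \<in> \<N> \<Longrightarrow> \<exists>M\<in>\<M>. norm (proj N - proj M) \<le> s"
  obtains S S' where "S \<in> bounded_ops" "S' \<in> bounded_ops"
    "S o\<^sub>L S' = id_blinfun" "S' o\<^sub>L S = id_blinfun" "{blinfun_apply S ` M | M. M \<in> \<M>} = \<N>"
proof -
  note cM = nest_closed_csubspace[OF \<M>] and cN = nest_closed_csubspace[OF \<N>]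
  have chain: "N \<subseteq> N' \<or> N' \<subseteq> N" if "N \<in> \<N>" "N' \<in> \<N>" for N N'
    using \<N> that by (simp add: is_nest_def)
  obtain \<theta> where \<theta>: "\<And>M. M \<in> \<M> \<Longrightarrow> \<theta> M \<in> \<N>" "\<And>M. M \<in> \<M> \<Longrightarrow> norm (proj (\<theta> M) - proj M) \<le> s"
    using close(1) by metis
  have mono: "N \<subseteq> N'" if "M \<in> \<M>" "M' \<in> \<M>" "N \<in> \<N>" "N' \<in> \<N>" "M \<subseteq> M'"
    "norm (proj N - proj M) \<le> s" "norm (proj N' - proj M') \<le> s" for M M' N N'
    using s that by (intro proj_close_mono[of M M' N N'] cM cN chain) auto
  have onto: "\<theta> ` \<M> = \<N>"
  proof
    show "\<N> \<subseteq> \<theta> ` \<M>"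
    proof
      fix N assume N: "N \<in> \<N>"
      then obtain M where M: "M \<in> \<M>" "norm (proj N - proj M) \<le> s" using close(2) by blast
      \<comment> \<open>Both \<open>N\<close> and \<open>\<theta> M\<close> are close to
        \<open>M\<close>; applying \<open>mono\<close> in both directions identifies them.\<close>
      have "N = \<theta> M"
        using mono[OF M(1) M(1) N \<theta>(1)[OF M(1)] subset_refl M(2) \<theta>(2)[OF M(1)]]
          mono[OF M(1) M(1) \<theta>(1)[OF M(1)] N subset_refl \<theta>(2)[OF M(1)] M(2)]
        by simp
      then show "N \<in> \<theta> ` \<M>" using M(1) by blast
    qed
  qed (use \<theta>(1) in auto)
  \<comment> \<open>Interpolation requires a bound strictly above \<open>s\<close>, invertibility of
    1 - Y one strictly below 1. The limit in the compactness argument keeps only norm Y \<le>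
    c.\<close>
  define c where "c = (s + 1) / 2"
  have c: "s < c" "0 < c" "c < 1" using s by (simp_all add: c_def)
  have "\<exists>Y\<in>bounded_ops. norm Y \<le> c \<and> (\<forall>M\<in>\<M>. \<forall>x\<in>M. x - blinfun_apply Y x \<in> \<theta> M)"
  proof (rule interpolation_compactness)
    fix F assume F: "finite F" "F \<subseteq> \<M>"
    have "\<exists>Y\<in>bounded_ops. norm Y < c \<and> (\<forall>M\<in>F. \<forall>x\<in>M. x - blinfun_apply Y x \<in> \<theta> M)"
    proof (rule finite_chain_interpolation[OF F(1) c(2)])
      fix M assume "M \<in> F"
      then have M: "M \<in> \<M>" using F(2) by blast
      show "closed_csubspace M" "closed_csubspace (\<theta> M)"
        using cM[OF M] cN[OF \<theta>(1)[OF M]] .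
      show "norm (proj (\<theta> M) - proj M) < c" using \<theta>(2)[OF M] c(1) by simp
      fix M' assume "M' \<in> F"
      then have M': "M' \<in> \<M>" using F(2) by blast
      show "M \<subseteq> M' \<or> M' \<subseteq> M" using \<M> M M' by (simp add: is_nest_def)
      show "\<theta> M \<subseteq> \<theta> M'" if "M \<subseteq> M'"
        by (rule mono[OF M M' \<theta>(1)[OF M] \<theta>(1)[OF M'] that \<theta>(2)[OF M] \<theta>(2)[OF M']])
    qed
    then show "\<exists>Y\<in>bounded_ops. norm Y \<le> c \<and> (\<forall>M\<in>F. \<forall>x\<in>M. x - blinfun_apply Y x \<in> \<theta> M)"
      by (meson less_imp_le)
  qed (use c \<theta>(1) cN in auto)
  then obtain Y where Y: "Y \<in> bounded_ops" "norm Y \<le> c"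
    "\<And>M x. M \<in> \<M> \<Longrightarrow> x \<in> M \<Longrightarrow> x - blinfun_apply Y x \<in> \<theta> M" by blast
  have Y1: "norm Y < 1" using Y(2) c(3) by simp
  define S where "S = id_blinfun - Y"
  have S: "S \<in> bounded_ops"
    unfolding S_def by (intro bounded_ops_diff bounded_ops_id Y(1))
  obtain S' where S': "S o\<^sub>L S' = id_blinfun" "S' o\<^sub>L S = id_blinfun"
    using neumann_inverse[OF Y1] unfolding S_def by blast
  have "S ` M = \<theta> M" if M: "M \<in> \<M>" for M
  proof -
    have "norm (proj (\<theta> M) - proj M) < 1" using \<theta>(2)[OF M] s(2) by simp
    then show ?thesis
      unfolding S_def
      by (rule perturbed_identity_image[OF cM[OF M] cN[OF \<theta>(1)[OF M]] _ Y1 Y(3)[OF M]])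
  qed
  then have "(\<lambda>M. S ` M) ` \<M> = \<theta> ` \<M>" by (rule image_cong[OF refl])
  moreover have "{blinfun_apply S ` M | M. M \<in> \<M>} = (\<lambda>M. S ` M) ` \<M>" by blast
  ultimately show ?thesis
    using that[OF S bounded_ops_inverse[OF S S'] S'] onto by simp
qed

theorem theorem4p4:
  fixes \<M> \<N> :: "'a::complex_hilbert_space set set"
  assumes "separable_space (euclidean :: 'a topology)"
    and "is_nest \<M>" and "is_nest \<N>"
    and "alg_dist (nest_algebra \<M>) (nest_algebra \<N>) < 1"
  shows "nest_dist \<M> \<N> < 1 \<and>
    (\<exists>S\<in>bounded_ops. \<exists>S'\<in>bounded_ops.
       S o\<^sub>L S' = id_blinfun \<and> S' o\<^sub>L S = id_blinfun \<and>
       {blinfun_apply S ` M | M. M \<in> \<M>} = \<N> \<and>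
       {S o\<^sub>L T o\<^sub>L S' | T. T \<in> nest_algebra \<M>} = nest_algebra \<N>)"
proof -
  note \<M> = assms(2) and \<N> = assms(3)
  \<comment> \<open>The maximum with 0 makes \<open>d\<close> positive. Its square root is taken
    because \<open>exists_close_nest_member\<close> turns an approximation constant s^2 into
    projection distance \<open>s\<close>.\<close>
  obtain d where d: "max 0 (alg_dist (nest_algebra \<M>) (nest_algebra \<N>)) < d" "d < 1"
    using dense[of "max 0 (alg_dist (nest_algebra \<M>) (nest_algebra \<N>))" 1] assms(4) by auto
  define s where "s = sqrt d"
  have s: "0 \<le> s" "s < 1" "s\<^sup>2 = d" using d by (simp_all add: s_def)
  have alg: "alg_dist (nest_algebra \<M>) (nest_algebra \<N>) < s\<^sup>2"
    "alg_dist (nest_algebra \<N>) (nest_algebra \<M>) < s\<^sup>2"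
    using d(1) s(3) alg_dist_commute[of "nest_algebra \<M>"] by auto
  have close: "\<exists>N\<in>\<N>. norm (proj N - proj M) \<le> s" if "M \<in> \<M>" for M
    using exists_close_nest_member[OF \<M> \<N> that s(1)] alg_dist_less_approx[OF \<M> \<N> alg(1)] by blast
  have close': "\<exists>M\<in>\<M>. norm (proj N - proj M) \<le> s" if "N \<in> \<N>" for N
    using exists_close_nest_member[OF \<N> \<M> that s(1)] alg_dist_less_approx[OF \<N> \<M> alg(2)]
    by (metis norm_minus_commute)
  have ne: "\<M> \<noteq> {}" "\<N> \<noteq> {}" using \<M> \<N> by (auto simp: is_nest_def)
  have INF_le: "(INF i\<in>I. norm (f i)) \<le> s" if "\<exists>i\<in>I. norm (f i) \<le> s"
    for I :: "'a set set" and f :: "_ \<Rightarrow> 'a \<Rightarrow>\<^sub>L 'a"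
    using that by (auto intro!: cINF_lower2 bdd_belowI2[of _ 0])
  \<comment> \<open>The uniform bound \<open>s\<close> keeps the suprema strictly below 1.\<close>
  have "nest_dist \<M> \<N> \<le> s"
    unfolding nest_dist_def
    by (intro max.boundedI cSUP_least ne INF_le close close')
  then have "nest_dist \<M> \<N> < 1" using s(2) by simp
  moreover obtain S S' where S: "S \<in> bounded_ops" "S' \<in> bounded_ops"
    and inv: "S o\<^sub>L S' = id_blinfun" "S' o\<^sub>L S = id_blinfun"
    and img: "{blinfun_apply S ` M | M. M \<in> \<M>} = \<N>"
    using close_nests_similar[OF \<M> \<N> s(1,2) close close'] by blast
  have inv': "S (S' x) = x" "S' (S x) = x" for x
    using inv by (metis blinfun_apply_blinfun_compose blinfun_apply_id_blinfun id_apply)+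
  have img': "{blinfun_apply S' ` N | N. N \<in> \<N>} = \<M>"
  proof -
    have "{blinfun_apply S' ` N | N. N \<in> \<N>} = (\<lambda>M. S' ` S ` M) ` \<M>"
      unfolding img[symmetric] by blast
    then show ?thesis by (simp add: image_image inv')
  qed
  have "T \<in> {S o\<^sub>L T o\<^sub>L S' | T. T \<in> nest_algebra \<M>}" if T: "T \<in> nest_algebra \<N>" for T
  proof -
    have "T = S o\<^sub>L (S' o\<^sub>L T o\<^sub>L S) o\<^sub>L S'"
      by (rule blinfun_eqI) (simp add: inv')
    then show ?thesis
      using nest_algebra_conjugate[OF S(2,1) inv(1) img' T] by blast
  qed
  then have "{S o\<^sub>L T o\<^sub>L S' | T. T \<in> nest_algebra \<M>} = nest_algebra \<N>"
    using nest_algebra_conjugate[OF S inv(2) img] by blast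
  ultimately show ?thesis using S inv img by blast
qed

end
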